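(* Let $\Theta^\infty(X)\in\mathbb{R}^{N\times N}$ be the infinite DNTK matrix for the Poisson equation with Dirichlet boundary condition, associated with the bias-free two-layer RePU network of order $s$ and the sampling points $X=X_I\sqcup X_B\subset\mathbb{R}^d$, where $X_I=\{x_p\}_{p=1}^{N_1}\subset\Omega$, $X_B=\{y_q\}_{q=1}^{N_2}\subset\partial\Omega$ and $N=N_1+N_2$ (see context for all definitions). Let $B_s(X)=\max_{p\in[N_1],\,q\in[N_2]}\{s(s-1)|x_p|^{s-2},\ |y_q|^{s}\}$. Then, for $d\ge2$ and $s\ge3$, $$\frac{2^{s-1}}{\sqrt{\pi}}\,\Gamma\left(s+\frac12\right)B_s^2(X)\ \le\ \lambda_{\max}(\Theta^\infty(X))\ \le\ \frac{2^{s-1}s^2}{\sqrt{\pi}}\,\frac{\Gamma(s+\frac d2)\,\Gamma(s-\frac52)}{\Gamma(s-2+\frac d2)}\,N\,B_s^2(X).$$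
   Context: Notation: $[n]=\{1,\dots,n\}$; $|\cdot|$ is the Euclidean norm; $\lambda_{\max}$ is the largest eigenvalue of a real symmetric matrix; $\Gamma$ is the Gamma function. $\Omega\subset\mathbb{R}^d$ is an open bounded domain with smooth boundary $\partial\Omega$. The interior points $x_1,\dots,x_{N_1}\in\Omega$ are pairwise distinct and the boundary points $y_1,\dots,y_{N_2}\in\partial\Omega$ are pairwise distinct, with $N_1,N_2\ge1$; $X=X_I\sqcup X_B$. Activation: $s\ge 3$ is an integer and $\sigma(t)=\sigma_s(t)=(t)_+^s$, where $(t)_+=t$ for $t\ge 0$ and $0$ otherwise (rectified power unit, RePU). The network is $f(x;\theta)=d_1^{-1/2}W^{(2)}\sigma(W^{(1)}x)$ without bias, with i.i.d. standard Gaussian parameters, in the limit of infinite width $d_1\to\infty$. Infinite DNTK (differential neural tangent kernel): for linear differential operators $\mathcal{A},\mathcal{B}$ and points $x,y\in\mathbb{R}^d$ (where $\mathcal{A}$ acts in the variable $x$, $\mathcal{B}$ acts in the variable $y$, and $x_k,y_k$ are the $k$-th components), $$\Theta^{\infty}(x^{\mathcal A},y^{\mathcal B})=\mathbb{E}_{u\sim\mathcal{N}(0,I_d)}\Big[\mathcal{A}\sigma(u^\top x)\,\mathcal{B}\sigma(u^\top y)+\sum_{k=1}^d \mathcal{A}\big(\sigma'(u^\top x)x_k\big)\,\mathcal{B}\big(\sigma'(u^\top y)y_k\big)\Big].$$ Infinite DNTK matrix: order the points as $x_1,\dots,x_{N_1},y_1,\dots,y_{N_2}$. The matrix $\Theta^\infty(X)\in\mathbb{R}^{N\times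 N}$ has as its entries the values of this kernel at pairs of points, where the Laplacian $\Delta$ is the operator attached to each interior point and the identity is the operator attached to each boundary point. Explicitly, for an interior point $x$ set $\varphi^{x}_0(u)=|u|^2\sigma''(u^\top x)$ and $\varphi^{x}_k(u)=x_k|u|^2\sigma'''(u^\top x)+2u_k\sigma''(u^\top x)$ for $k\in[d]$; for a boundary point $y$ set $\varphi^{y}_0(u)=\sigma(u^\top y)$ and $\varphi^{y}_k(u)=y_k\sigma'(u^\top y)$ for $k\in[d]$. Then the entry for points $z,z'$ is $\mathbb{E}_{u\sim\mathcal N(0,I_d)}\big[\sum_{k=0}^d\varphi^{z}_k(u)\varphi^{z'}_k(u)\big]$. (For $s=3$ the value of $\sigma'''$ at $0$ is immaterial.) *)

theory Defs
  imports "HOL-Probability.Probability"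
begin

definition partial_deriv :: "'n::finite \<Rightarrow> (real^'n \<Rightarrow> real) \<Rightarrow> real^'n \<Rightarrow> real" where
  "partial_deriv i f x = deriv (\<lambda>t. f (x + t *\<^sub>R axis i 1)) 0"

definition laplacian :: "(real^'n::finite \<Rightarrow> real) \<Rightarrow> real^'n \<Rightarrow> real" where
  "laplacian f x = (\<Sum>i\<in>UNIV. partial_deriv i (partial_deriv i f) x)"

text \<open>On an open set, being of class C-infinity is the same as having iterated partial
  derivatives of every order that are all (totally) differentiable; continuity of these
  partial derivatives is then automatic.\<close>

definition smooth_fun_on :: "(real^'n::finite) set \<Rightarrow> (real^'n \<Rightarrow> real) \<Rightarrow> bool" where
  "smooth_fun_on U f \<longleftrightarrow>
     open U \<and> (\<forall>is. \<forall>x\<in>U. foldr partial_deriv is f differentiable (at x))"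

text \<open>Locally the set is the strict sublevel set of a smooth function with nowhere vanishing
  gradient.  By the implicit function theorem this is equivalent to the set being locally the
  region on one side of the graph of a smooth function.\<close>

definition smooth_boundary :: "(real^'n::finite) set \<Rightarrow> bool" where
  "smooth_boundary \<Omega> \<longleftrightarrow>
     (\<forall>p\<in>frontier \<Omega>. \<exists>U \<rho>. p \<in> U \<and> smooth_fun_on U \<rho> \<and>
        (\<forall>z\<in>U. \<exists>i. partial_deriv i \<rho> z \<noteq> 0) \<and> \<Omega> \<inter> U = {z\<in>U. \<rho> z < 0})"

definition repu :: "nat \<Rightarrow> real \<Rightarrow> real" where
  "repu s t = (max 0 t) ^ s"

definition std_gaussian :: "(real^'n::finite) measure" where
  "std_gaussian = density lborel (\<lambda>u. ennreal (\<Prod>i\<in>UNIV. std_normal_density (u $ i)))"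

type_synonym 'n operator = "(real^'n \<Rightarrow> real) \<Rightarrow> real^'n \<Rightarrow> real"

text \<open>The kernel of the bias-free two-layer network in the infinite-width limit, with an operator
  attached to each argument.  For the Laplacian and \<open>s = 3\<close>, the second derivatives of
  \<open>\<lambda>z. deriv (repu s) (u \<bullet> z) * z $ k\<close> at a point \<open>x \<noteq> 0\<close> can fail to exist only for \<open>u\<close> in the
  hyperplane \<open>u \<bullet> x = 0\<close>, a null set; at \<open>x = 0\<close> they exist for every \<open>u\<close>.\<close>

definition dntk :: "nat \<Rightarrow> 'n::finite operator \<Rightarrow> real^'n \<Rightarrow> 'n operator \<Rightarrow> real^'n \<Rightarrow> real" where
  "dntk s A x B y =
     (\<integral>u. A (\<lambda>z. repu s (u \<bullet> z)) x * B (\<lambda>z. repu s (u \<bullet> z)) y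
        + (\<Sum>k\<in>UNIV. A (\<lambda>z. deriv (repu s) (u \<bullet> z) * z $ k) x
                    * B (\<lambda>z. deriv (repu s) (u \<bullet> z) * z $ k) y) \<partial>std_gaussian)"

text \<open>The interior points are indexed by \<open>'p\<close> and the boundary points by \<open>'q\<close>, so that
  \<open>CARD('p) = N\<^sub>1\<close> and \<open>CARD('q) = N\<^sub>2\<close>; rows and columns of the matrix are indexed by \<open>'p + 'q\<close>.\<close>

fun sample_point :: "('p \<Rightarrow> real^'n) \<Rightarrow> ('q \<Rightarrow> real^'n) \<Rightarrow> 'p + 'q \<Rightarrow> real^'n" where
  "sample_point x y (Inl p) = x p"
| "sample_point x y (Inr q) = y q"

fun sample_operator :: "'p + 'q \<Rightarrow> 'n::finite operator" where
  "sample_operator (Inl p) = laplacian"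
| "sample_operator (Inr q) = (\<lambda>f. f)"

definition dntk_matrix ::
  "nat \<Rightarrow> ('p::finite \<Rightarrow> real^'n::finite) \<Rightarrow> ('q::finite \<Rightarrow> real^'n) \<Rightarrow> real^('p + 'q)^('p + 'q)" where
  "dntk_matrix s x y =
     (\<chi> a b. dntk s (sample_operator a) (sample_point x y a) (sample_operator b) (sample_point x y b))"

definition eigenvalues :: "real^'m^'m::finite \<Rightarrow> real set" where
  "eigenvalues A = {c. \<exists>v. v \<noteq> 0 \<and> A *v v = c *\<^sub>R v}"

definition lambda_max :: "real^'m^'m::finite \<Rightarrow> real" where
  "lambda_max A = Max (eigenvalues A)"

definition B_bound ::
  "nat \<Rightarrow> ('p::finite \<Rightarrow> real^'n::finite) \<Rightarrow> ('q::finite \<Rightarrow> real^'n) \<Rightarrow> real" where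
  "B_bound s x y =
     Max (range (\<lambda>p. real s * (real s - 1) * norm (x p) ^ (s - 2)) \<union> range (\<lambda>q. norm (y q) ^ s))"

end

theory Submission
  imports Defs "HOL-Real_Asymp.Real_Asymp"
begin

text \<open>The matrix is symmetric, so its largest eigenvalue is at least each diagonal entry, and at most
  \<open>N\<close> times any bound for the absolute values of the entries; by \<open>2\<bar>ab\<bar> \<le> a\<^sup>2 + b\<^sup>2\<close> under the integral the
  entries are bounded by the largest diagonal entry.  The diagonal entries are explicit combinations
  of the Gaussian moments of \<open>|u|\<^sup>2\<^sup>j (u \<bullet> x)\<^sub>+\<^sup>2\<^sup>m\<close>.  Here \<open>u \<bullet> x\<close> is a one-dimensional Gaussian, and
  each factor \<open>|u|\<^sup>2\<close> in front of a function \<open>h\<close> homogeneous of degree \<open>p\<close> multiplies its expectation by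
  \<open>p + d\<close>.  Both bounds for the diagonal then become polynomial inequalities in \<open>s\<close> and \<open>d\<close>.\<close>

section \<open>Largest eigenvalue of a symmetric matrix\<close>

lemma inner_symmetric_matrix:
  fixes A :: "real^'m^'m"
  assumes "transpose A = A"
  shows "v \<bullet> (A *v w) = (A *v v) \<bullet> w"
  using assms by (metis dot_lmul_matrix transpose_matrix_vector)

text \<open>One eigenvector per eigenvalue gives pairwise orthogonal nonzero vectors, hence an
  independent set. Finiteness gives meaning to the \<open>Max\<close> in
  \<open>lambda_max\<close>.\<close>

lemma finite_eigenvalues:
  fixes A :: "real^'m^'m"
  assumes sym: "transpose A = A"
  shows "finite (eigenvalues A)"
proof -
  have "\<forall>c\<in>eigenvalues A. \<exists>v. v \<noteq> 0 \<and> A *v v = c *\<^sub>R v"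
    by (simp add: eigenvalues_def)
  then obtain f where f: "\<And>c. c \<in> eigenvalues A \<Longrightarrow> f c \<noteq> 0 \<and> A *v f c = c *\<^sub>R f c"
    by metis
  have orth: "f a \<bullet> f b = 0" if "a \<in> eigenvalues A" "b \<in> eigenvalues A" "a \<noteq> b" for a b
  proof -
    have "b * (f a \<bullet> f b) = a * (f a \<bullet> f b)"
      using inner_symmetric_matrix[OF sym, of "f a" "f b"] f that by simp
    with that show ?thesis by simp
  qed
  have "independent (f ` eigenvalues A)"
    using f orth by (intro pairwise_orthogonal_independent) (auto simp: pairwise_def orthogonal_def)
  moreover have "inj_on f (eigenvalues A)"
    using f orth by (metis inj_onI inner_eq_zero_iff)
  ultimately show ?thesis
    using independent_imp_finite finite_imageD by blast
qed

text \<open>The quadratic form attains its maximum \<open>c\<close> on the compact unit sphere. At a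
  maximiser \<open>v\<close> the residual \<open>c *\<^sub>R v - A *v v\<close> vanishes, since
  otherwise a small step against it would violate the bound. This also shows that eigenvalues
  exist.\<close>

lemma Rayleigh_maximum_eigenvalue:
  fixes A :: "real^'m^'m"
  assumes sym: "transpose A = A"
  obtains c where "c \<in> eigenvalues A" "\<And>w. w \<bullet> (A *v w) \<le> c * (w \<bullet> w)"
proof -
  have "continuous_on (sphere 0 1) (\<lambda>v. v \<bullet> (A *v v))"
    by (intro continuous_intros linear_continuous_on matrix_vector_mul_bounded_linear)
  moreover have "sphere (0::real^'m) 1 \<noteq> {}" by simp
  ultimately obtain v where v: "norm v = 1"
      and vmax: "\<And>w. norm w = 1 \<Longrightarrow> w \<bullet> (A *v w) \<le> v \<bullet> (A *v v)"
    using continuous_attains_sup[OF compact_sphere, of 0 1 "\<lambda>v. v \<bullet> (A *v v)"] by auto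
  define c where "c = v \<bullet> (A *v v)"
  have Ray: "w \<bullet> (A *v w) \<le> c * (w \<bullet> w)" for w
  proof (cases "w = 0")
    case False
    have "(w /\<^sub>R norm w) \<bullet> (A *v (w /\<^sub>R norm w)) \<le> c"
      unfolding c_def using False by (intro vmax) simp
    then show ?thesis
      using False by (simp add: matrix_vector_mult_scaleR dot_square_norm field_simps power2_eq_square)
  qed simp
  have "c *\<^sub>R v - A *v v = 0"
  proof (rule ccontr)
    assume nz: "c *\<^sub>R v - A *v v \<noteq> 0"
    define g where "g = c *\<^sub>R v - A *v v"
    define b q where "b = g \<bullet> g" and "q = c * b - g \<bullet> (A *v g)"
    have b: "b > 0" using nz by (simp add: b_def g_def)
    \<comment> \<open>Expand the Rayleigh bound at \<open>v + t *\<^sub>R g\<close>. The constant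
      terms cancel, and the linear coefficient is \<open>2 * b\<close> because
      \<open>b = c * (v \<bullet> g) - (A *v v) \<bullet> g\<close>.\<close>
    have quad: "0 \<le> t * (2 * b + t * q)" for t
    proof -
      have "(v + t *\<^sub>R g) \<bullet> (A *v (v + t *\<^sub>R g)) \<le> c * ((v + t *\<^sub>R g) \<bullet> (v + t *\<^sub>R g))"
        by (rule Ray)
      moreover have "(v + t *\<^sub>R g) \<bullet> (A *v (v + t *\<^sub>R g))
          = v \<bullet> (A *v v) + 2 * t * ((A *v v) \<bullet> g) + t * t * (g \<bullet> (A *v g))"
        by (simp only: inner_symmetric_matrix[OF sym, of v g] inner_commute[of g "A *v v"] matrix_vector_right_distrib matrix_vector_mult_scaleR inner_add_left
            inner_add_right inner_scaleR_left inner_scaleR_right)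
          (simp add: algebra_simps)
      moreover have "(v + t *\<^sub>R g) \<bullet> (v + t *\<^sub>R g) = v \<bullet> v + 2 * t * (v \<bullet> g) + t * t * b"
        by (simp only: b_def inner_add_left inner_add_right inner_scaleR_left inner_scaleR_right
            inner_commute[of g v]) (simp add: algebra_simps)
      moreover have "v \<bullet> v = 1" using v by (simp add: dot_square_norm)
      moreover have b_eq: "b = c * (v \<bullet> g) - (A *v v) \<bullet> g"
        unfolding b_def by (subst (1) g_def) (simp add: inner_diff_left)
      ultimately have "c + 2 * t * ((A *v v) \<bullet> g) + t * t * (g \<bullet> (A *v g))
          \<le> c * (1 + 2 * t * (v \<bullet> g) + t * t * b)"
        by (simp only: c_def)
      then have "0 \<le> 2 * t * (c * (v \<bullet> g) - (A *v v) \<bullet> g) + t * t * q"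
        by (simp add: q_def algebra_simps)
      then show ?thesis
        unfolding b_eq[symmetric] by (simp add: algebra_simps)
    qed
    \<comment> \<open>A negative \<open>t\<close> so small that
      \<open>\<bar>t * q\<bar> \<le> b\<close> keeps \<open>2 * b + t * q\<close> positive and makes
      the product negative; the summand 1 covers \<open>q = 0\<close>.\<close>
    define t where "t = - b / (1 + \<bar>q\<bar>)"
    have "t < 0" using b by (simp add: t_def)
    moreover have "\<bar>t * q\<bar> \<le> b"
      using b by (simp add: t_def abs_mult field_simps)
    then have "2 * b + t * q > 0" using b by linarith
    ultimately show False using quad[of t] by (simp add: mult_less_0_iff zero_le_mult_iff)
  qed
  moreover have "v \<noteq> 0" using v by auto
  ultimately have "c \<in> eigenvalues A" by (auto simp: eigenvalues_def)
  then show thesis using Ray by (rule that)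
qed

text \<open>A diagonal entry is the Rayleigh quotient of the unit vector
  \<open>axis a 1\<close>.\<close>

lemma lambda_max_ge_diagonal:
  fixes A :: "real^'m^'m"
  assumes "transpose A = A"
  shows "A $ a $ a \<le> lambda_max A"
proof -
  obtain c where c: "c \<in> eigenvalues A" "\<And>w. w \<bullet> (A *v w) \<le> c * (w \<bullet> w)"
    using Rayleigh_maximum_eigenvalue[OF assms] by blast
  have "A $ a $ a \<le> c"
    using c(2)[of "axis a 1"] by (simp add: inner_axis' matrix_vector_mult_basis column_def)
  also have "c \<le> lambda_max A"
    unfolding lambda_max_def using c(1) finite_eigenvalues[OF assms] by simp
  finally show ?thesis .
qed

text \<open>Evaluate the quadratic form at an eigenvector of the largest eigenvalue, bound it
  entrywise, and apply Cauchy-Schwarz to the sum of the \<open>\<bar>v $ a\<bar>\<close>; that last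
  step produces the dimension.\<close>

lemma lambda_max_le_entry_bound:
  fixes A :: "real^'m^'m"
  assumes sym: "transpose A = A" and D: "\<And>a b. \<bar>A $ a $ b\<bar> \<le> D"
  shows "lambda_max A \<le> real CARD('m) * D"
proof -
  have "lambda_max A \<in> eigenvalues A"
    unfolding lambda_max_def
    using Rayleigh_maximum_eigenvalue[OF sym] finite_eigenvalues[OF sym] by (metis Max_in empty_iff)
  then obtain v where v: "v \<noteq> 0" "A *v v = lambda_max A *\<^sub>R v"
    by (auto simp: eigenvalues_def)
  have "0 \<le> D" using D[of undefined undefined] by linarith
  have "lambda_max A * (v \<bullet> v) = v \<bullet> (A *v v)" by (simp add: v)
  also have "\<dots> = (\<Sum>a\<in>UNIV. \<Sum>b\<in>UNIV. A $ a $ b * (v $ a * v $ b))"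
    by (simp add: inner_vec_def matrix_vector_mult_def sum_distrib_left mult_ac)
  also have "\<dots> \<le> (\<Sum>a\<in>UNIV. \<Sum>b\<in>UNIV. D * (\<bar>v $ a\<bar> * \<bar>v $ b\<bar>))"
  proof (intro sum_mono)
    fix a b
    have "A $ a $ b * (v $ a * v $ b) \<le> \<bar>A $ a $ b\<bar> * \<bar>v $ a * v $ b\<bar>"
      by (metis abs_ge_self abs_mult)
    also have "\<dots> \<le> D * \<bar>v $ a * v $ b\<bar>" by (intro mult_right_mono D) simp
    finally show "A $ a $ b * (v $ a * v $ b) \<le> D * (\<bar>v $ a\<bar> * \<bar>v $ b\<bar>)"
      by (simp add: abs_mult)
  qed
  also have "\<dots> = D * (\<Sum>a\<in>UNIV. \<bar>v $ a\<bar>)\<^sup>2"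
    by (simp add: power2_eq_square sum_product) (simp add: sum_distrib_left)
  also have "\<dots> \<le> D * ((\<Sum>a\<in>UNIV. \<bar>v $ a\<bar>\<^sup>2) * real CARD('m))"
    using \<open>0 \<le> D\<close> Cauchy_Schwarz_ineq_sum[of "\<lambda>a. \<bar>v $ a\<bar>" "\<lambda>_. 1" UNIV]
    by (intro mult_left_mono) simp_all
  also have "\<dots> = real CARD('m) * D * (v \<bullet> v)"
    by (simp add: inner_vec_def power2_eq_square)
  finally show ?thesis using v(1) by simp
qed

section \<open>Laplacians of the RePU features\<close>

text \<open>Unlike \<open>repu\<close>, this vanishes at 0 for exponent 0 too: \<open>tpow 0\<close>
  is the indicator of the positive reals, which serves as the derivative of \<open>tpow 1\<close>
  off 0, and exponents add under multiplication without exception.\<close>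

definition tpow :: "nat \<Rightarrow> real \<Rightarrow> real" where
  "tpow m t = (if t > 0 then t ^ m else 0)"

lemma tpow_nonneg [simp]: "0 \<le> tpow m t"
  by (simp add: tpow_def)

lemma tpow_zero [simp]: "tpow m 0 = 0"
  by (simp add: tpow_def)

lemma tpow_mult: "tpow m t * tpow k t = tpow (m + k) t"
  by (simp add: tpow_def power_add)

lemma tpow_Suc: "tpow (Suc m) t = t * tpow m t"
  by (simp add: tpow_def)

lemma tpow_2: "tpow (Suc (Suc 0)) t = t * tpow (Suc 0) t"
  by (simp add: tpow_def)

lemma tpow_scale: "0 < c \<Longrightarrow> tpow m (c * t) = c ^ m * tpow m t"
  by (simp add: tpow_def zero_less_mult_iff power_mult_distrib)

lemma tpow_measurable [measurable]: "tpow m \<in> borel_measurable borel"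
  unfolding tpow_def by measurable

lemma repu_eq_tpow: "0 < s \<Longrightarrow> repu s = tpow s"
  by (auto simp: fun_eq_iff repu_def tpow_def max_def)

lemma isCont_tpow: "0 < m \<Longrightarrow> isCont (tpow m) t"
  by (simp flip: repu_eq_tpow) (simp add: repu_def [abs_def] isCont_def tendsto_intros continuous_intros)

text \<open>Off 0 the function is locally a power or zero. At 0, Caratheodory's criterion applies to
  the factorisation \<open>t * tpow m t\<close>, where \<open>tpow m\<close> is continuous for
  positive \<open>m\<close>.\<close>

lemma DERIV_tpow:
  assumes "0 < m \<or> t \<noteq> 0"
  shows "(tpow (Suc m) has_real_derivative (real (Suc m) * tpow m t)) (at t)"
proof -
  consider "t > 0" | "t < 0" | "t = 0" by linarith
  then show ?thesis
  proof cases
    case 1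
    have "((\<lambda>t. t ^ Suc m) has_real_derivative (real (Suc m) * tpow m t)) (at t)"
      using DERIV_pow[of "Suc m" t UNIV] 1 by (simp add: tpow_def)
    then show ?thesis
      by (rule has_field_derivative_transform_within_open[where S = "{0<..}"])
        (use 1 in \<open>auto simp: tpow_def\<close>)
  next
    case 2
    have "((\<lambda>t. 0) has_real_derivative (real (Suc m) * tpow m t)) (at t)"
      using 2 by (auto simp: tpow_def)
    then show ?thesis
      by (rule has_field_derivative_transform_within_open[where S = "{..<0}"])
        (use 2 in \<open>auto simp: tpow_def\<close>)
  next
    case 3
    then show ?thesis
      using assms isCont_tpow[of m 0]
      by (auto simp: CARAT_DERIV tpow_Suc intro!: exI[of _ "tpow m"])
  qed
qed

lemma DERIV_tpow_chain [derivative_intros]: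
  assumes "0 < m \<or> g t \<noteq> 0" "(g has_real_derivative g') (at t)"
    and "real (Suc m) * tpow m (g t) * g' = D"
  shows "((\<lambda>t. tpow (Suc m) (g t)) has_real_derivative D) (at t)"
  using DERIV_chain2[OF DERIV_tpow[OF assms(1)] assms(2)] assms(3) by simp

text \<open>The right and left difference quotients at 0 are constantly 1 and 0.\<close>

lemma not_DERIV_tpow_one: "\<not> (tpow 1 has_real_derivative D) (at 0)"
proof
  assume "(tpow 1 has_real_derivative D) (at 0)"
  then have lim: "((\<lambda>h. tpow 1 h / h) \<longlongrightarrow> D) (at 0)"
    by (simp add: DERIV_def)
  have "((\<lambda>h. tpow 1 h / h) \<longlongrightarrow> D) (at_right 0)" "((\<lambda>h. tpow 1 h / h) \<longlongrightarrow> D) (at_left 0)"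
    by (rule tendsto_mono[OF _ lim], simp add: at_le)+
  moreover have "((\<lambda>h. tpow 1 h / h) \<longlongrightarrow> 1) (at_right 0)" "((\<lambda>h. tpow 1 h / h) \<longlongrightarrow> 0) (at_left 0)"
    by (rule tendsto_eventually, simp add: tpow_def eventually_at_filter)+
  ultimately have "D = 1" "D = 0"
    by (auto intro: tendsto_unique[rotated])
  then show False by simp
qed

text \<open>The factor \<open>t\<close> makes the product differentiable at 0 where \<open>g\<close>
  is merely continuous, as happens for multiples of \<open>tpow 1\<close>.\<close>

lemma DERIV_mult_self_at_zero:
  fixes g :: "real \<Rightarrow> real"
  assumes "isCont g 0"
  shows "((\<lambda>t. t * g t) has_real_derivative g 0) (at 0)"
  using assms by (auto simp: CARAT_DERIV intro!: exI[of _ g])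

section \<open>Partial derivatives and Laplacians of the features\<close>

lemma partial_deriv_eqI:
  "((\<lambda>t. f (z + t *\<^sub>R axis i 1)) has_real_derivative D) (at 0) \<Longrightarrow> partial_deriv i f z = D"
  unfolding partial_deriv_def by (rule DERIV_imp_deriv)

text \<open>Writing the order as \<open>n + 3\<close> builds in the bound on \<open>s\<close> and
  keeps the exponents of all derivatives free of truncated subtraction.\<close>

lemma deriv_repu: "deriv (repu (n + 3)) = (\<lambda>t. (real n + 3) * tpow (n + 2) t)"
proof
  fix t
  show "deriv (repu (n + 3)) t = (real n + 3) * tpow (n + 2) t"
    using DERIV_tpow[of "n + 2" t]
    by (intro DERIV_imp_deriv) (simp add: repu_eq_tpow numeral_3_eq_3 add.commute)
qed

text \<open>Two derivatives leave the exponent \<open>n + 1 \<ge> 1\<close>, so the formula holds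
  for every \<open>u\<close>, also on the hyperplane \<open>u \<bullet> x = 0\<close>.\<close>

lemma laplacian_repu:
  "laplacian (\<lambda>z. repu (n + 3) (u \<bullet> z)) x
     = (real n + 3) * (real n + 2) * (u \<bullet> u) * tpow (n + 1) (u \<bullet> x)"
proof -
  have eq: "n + 3 = Suc (n + 2)" "n + 2 = Suc (n + 1)" by simp_all
  have repu: "repu (n + 3) = tpow (n + 3)" by (rule repu_eq_tpow) simp
  have 1: "partial_deriv i (\<lambda>z. repu (n + 3) (u \<bullet> z)) = (\<lambda>z. (real n + 3) * tpow (n + 2) (u \<bullet> z) * u $ i)" for i
    unfolding repu unfolding eq(1)
    by (rule ext, rule partial_deriv_eqI)
      (auto simp: inner_add_right inner_axis intro!: derivative_eq_intros)
  have 2: "partial_deriv i (\<lambda>z. (real n + 3) * tpow (n + 2) (u \<bullet> z) * u $ i) x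
      = (real n + 3) * (real n + 2) * tpow (n + 1) (u \<bullet> x) * (u $ i * u $ i)" for i
    unfolding eq(2)
    by (rule partial_deriv_eqI)
      (auto simp: inner_add_right inner_axis intro!: derivative_eq_intros)
  show ?thesis
    unfolding laplacian_def 1 2
    by (simp add: inner_vec_def sum_distrib_left sum_distrib_right mult_ac)
qed

lemma partial_deriv_weighted_tpow:
  "partial_deriv i (\<lambda>z. (real n + 3) * tpow (n + 2) (u \<bullet> z) * z $ k)
     = (\<lambda>z. (real n + 3) * (real n + 2) * tpow (n + 1) (u \<bullet> z) * u $ i * z $ k
          + (real n + 3) * tpow (n + 2) (u \<bullet> z) * (axis i 1 $ k))"
proof -
  have eq: "n + 2 = Suc (n + 1)" by simp
  show ?thesis
    by (rule ext, rule partial_deriv_eqI)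
      (auto simp: inner_add_right inner_axis eq simp del: add_2_eq_Suc' add_Suc_right intro!: derivative_eq_intros)
qed

text \<open>For \<open>n = 0\<close> (order \<open>s = 3\<close>) the first derivative has a kink on the hyperplane \<open>u \<bullet> x = 0\<close> unless
  \<open>u $ i = 0\<close> or \<open>x $ k = 0\<close>.  At the kink \<open>deriv\<close> returns a fixed junk value; the hyperplane is a null
  set, but the value is needed for Borel measurability.\<close>

lemma partial_deriv2_weighted_tpow:
  assumes "0 < n \<or> u \<bullet> x \<noteq> 0 \<or> u $ i = 0 \<or> x $ k = 0"
  shows "partial_deriv i (partial_deriv i (\<lambda>z. (real n + 3) * tpow (n + 2) (u \<bullet> z) * z $ k)) x
     = (real n + 3) * (real n + 2)
        * ((real n + 1) * tpow n (u \<bullet> x) * (u $ i * u $ i) * x $ k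
           + 2 * tpow (n + 1) (u \<bullet> x) * u $ i * axis i 1 $ k)"
proof (cases "0 < n \<or> u \<bullet> x \<noteq> 0")
  case True
  have eq: "n + 2 = Suc (n + 1)" "n + 1 = Suc n" by simp_all
  show ?thesis
    unfolding partial_deriv_weighted_tpow
    by (rule partial_deriv_eqI, unfold eq)
      (use True in \<open>auto simp: inner_add_right inner_axis algebra_simps intro!: derivative_eq_intros\<close>)
next
  case False
  then have n: "n = 0" and ux: "u \<bullet> x = 0" and *: "u $ i = 0 \<or> x $ k = 0" using assms by auto
  show ?thesis
  proof (cases "u $ i = 0")
    case True
    have "((\<lambda>t. 0) has_real_derivative 0) (at 0)" by simp
    then show ?thesis
      unfolding partial_deriv_weighted_tpow n
      by (intro partial_deriv_eqI) (simp add: inner_add_right inner_axis ux True)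
  next
    case False
    \<comment> \<open>Here \<open>x $ k = 0\<close>, so along the line both terms of the first
      derivative carry a factor \<open>t\<close>. Their coefficients 6 and 3 add up to 9, because
      \<open>tpow 2 w = w * tpow 1 w\<close>.\<close>
    let ?G = "\<lambda>t. 9 * u $ i * axis i 1 $ k * tpow 1 (t * u $ i)"
    have "isCont ?G 0"
      by (intro continuous_intros isCont_o2[OF _ isCont_tpow]) simp
    from DERIV_mult_self_at_zero[OF this] show ?thesis
      unfolding partial_deriv_weighted_tpow n using False *
      by (intro partial_deriv_eqI)
        (simp add: inner_add_right inner_axis ux tpow_2 algebra_simps)
  qed
qed

text \<open>The first derivative along the line is a differentiable function plus a nonzero multiple
  of \<open>tpow 1 (t * u $ i)\<close>. Hence no derivative exists at 0, and the choice operator in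
  \<open>deriv\<close> is applied to an unsatisfiable predicate.\<close>

lemma partial_deriv2_weighted_tpow_kink:
  assumes n: "n = 0" and ux: "u \<bullet> x = 0" and nz: "u $ i \<noteq> 0" "x $ k \<noteq> 0"
  shows "partial_deriv i (partial_deriv i (\<lambda>z. (real n + 3) * tpow (n + 2) (u \<bullet> z) * z $ k)) x
     = (SOME D. False)"
proof -
  let ?f = "\<lambda>t. 6 * u $ i * x $ k * tpow 1 (t * u $ i)
      + t * (9 * u $ i * axis i 1 $ k * tpow 1 (t * u $ i))"
  have "\<not> (?f has_real_derivative D) (at 0)" for D
  proof
    assume f: "(?f has_real_derivative D) (at 0)"
    let ?G = "\<lambda>t. 9 * u $ i * axis i 1 $ k * tpow 1 (t * u $ i)"
    have "isCont ?G 0"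
      by (intro continuous_intros isCont_o2[OF _ isCont_tpow]) simp
    from DERIV_diff[OF f DERIV_mult_self_at_zero[OF this]]
    have 1: "((\<lambda>t. 6 * u $ i * x $ k * tpow 1 (t * u $ i)) has_real_derivative D) (at ((\<lambda>t. t / u $ i) 0))"
      by simp
    \<comment> \<open>Substituting \<open>t / u $ i\<close> cancels the slope, whatever its sign,
      and reduces the claim to \<open>tpow 1\<close> itself.\<close>
    have "((\<lambda>t. 6 * u $ i * x $ k * tpow 1 (t / u $ i * u $ i)) has_real_derivative
        D * (1 / u $ i)) (at 0)"
      by (rule DERIV_chain2[where f = "\<lambda>t. 6 * u $ i * x $ k * tpow 1 (t * u $ i)" and g = "\<lambda>t. t / u $ i", OF 1]) (auto intro!: derivative_eq_intros simp: nz)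
    from DERIV_cdivide[OF this, of "6 * u $ i * x $ k"]
    have "(tpow 1 has_real_derivative (D * (1 / u $ i)) / (6 * u $ i * x $ k)) (at 0)"
      using nz by simp
    then show False using not_DERIV_tpow_one by blast
  qed
  moreover have "partial_deriv i (\<lambda>z. (real n + 3) * tpow (n + 2) (u \<bullet> z) * z $ k) (x + t *\<^sub>R axis i 1) = ?f t" for t
    unfolding partial_deriv_weighted_tpow n
    by (simp add: inner_add_right inner_axis ux tpow_2 algebra_simps)
  ultimately show ?thesis
    by (subst partial_deriv_def) (simp add: deriv_def)
qed

section \<open>Gaussian moments\<close>

abbreviation std_normal :: "real measure" where
  "std_normal \<equiv> density lborel (\<lambda>t. ennreal (std_normal_density t))"

section \<open>Coordinates and one-dimensional projections of the Gaussian measure\<close>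

lemma measurable_nth [measurable]: "(\<lambda>u::real^'n. u $ i) \<in> borel_measurable borel"
  by (intro borel_measurable_continuous_onI continuous_intros)

lemma sets_std_gaussian [simp, measurable_cong]: "sets std_gaussian = sets borel"
  by (simp add: std_gaussian_def)

lemma space_std_gaussian [simp]: "space std_gaussian = UNIV"
  by (simp add: std_gaussian_def)

text \<open>Both the density and Lebesgue measure are products over the coordinates, so Tonelli's
  theorem separates the integral.\<close>

lemma nn_integral_std_gaussian_prod:
  fixes f :: "'n::finite \<Rightarrow> real \<Rightarrow> ennreal"
  assumes [measurable]: "\<And>i. f i \<in> borel_measurable borel"
  shows "(\<integral>\<^sup>+u. (\<Prod>i\<in>UNIV. f i (u $ i)) \<partial>std_gaussian) = (\<Prod>i\<in>UNIV. \<integral>\<^sup>+t. f i t \<partial>std_normal)"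
proof -
  define e where "e = (\<lambda>i::'n. axis i (1::real))"
  have inj: "inj e" by (auto simp: e_def inj_on_def axis_eq_axis)
  have Basis: "Basis = range e" by (auto simp: Basis_vec_def e_def)
  \<comment> \<open>Lebesgue measure factors over the set \<open>Basis\<close>; \<open>F\<close>
    carries the factors from the index type to basis vectors through the inverse of
    \<open>e\<close>.\<close>
  define F where "F = (\<lambda>b t. ennreal (std_normal_density t) * f (the_inv e b) t)"
  have Fe: "F (e i) = (\<lambda>t. ennreal (std_normal_density t) * f i t)" for i
    by (simp add: F_def the_inv_f_f[OF inj])
  have "(\<integral>\<^sup>+u. (\<Prod>i\<in>UNIV. f i (u $ i)) \<partial>std_gaussian)
      = (\<integral>\<^sup>+u. ennreal (\<Prod>i\<in>UNIV. std_normal_density (u $ i)) * (\<Prod>i\<in>UNIV. f i (u $ i)) \<partial>lborel)"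
    unfolding std_gaussian_def by (rule nn_integral_density) measurable
  also have "\<dots> = (\<integral>\<^sup>+u. (\<Prod>b\<in>Basis. F b (u \<bullet> b)) \<partial>lborel)"
    unfolding Basis by (subst prod.reindex[OF inj])
      (simp add: Fe prod_ennreal prod.distrib e_def[symmetric], simp add: e_def inner_axis)
  also have "\<dots> = (\<Prod>b\<in>Basis. \<integral>\<^sup>+t. F b t \<partial>lborel)"
    by (rule nn_integral_lborel_prod) (auto simp: F_def)
  also have "\<dots> = (\<Prod>i\<in>UNIV. \<integral>\<^sup>+t. f i t \<partial>std_normal)"
    unfolding Basis by (subst prod.reindex[OF inj]) (simp add: Fe nn_integral_density)
  finally show ?thesis .
qed

interpretation std_normal: prob_space std_normal
  by (rule prob_space_normal_density) simp

interpretation std_gaussian: prob_space "std_gaussian :: (real^'n::finite) measure"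
proof
  have "integral\<^sup>N std_gaussian (\<lambda>u::real^'n. \<Prod>i\<in>(UNIV::'n set). 1) = (\<Prod>i\<in>(UNIV::'n set). \<integral>\<^sup>+t. 1 \<partial>std_normal)"
    by (rule nn_integral_std_gaussian_prod) simp
  then show "emeasure (std_gaussian :: (real^'n) measure) (space std_gaussian) = 1"
    using std_normal.emeasure_space_1 by simp
qed

lemma prob_std_gaussian_box:
  assumes [measurable]: "\<And>i. A i \<in> sets borel"
  shows "std_gaussian.prob (\<Inter>i. {u::real^'n. u $ i \<in> A i}) = (\<Prod>i\<in>UNIV. std_normal.prob (A i))"
proof -
  have [measurable]: "(\<Inter>i. {u::real^'n. u $ i \<in> A i}) \<in> sets borel"
    by (auto intro!: sets.finite_INT)
  have ind: "(\<Prod>i\<in>UNIV. indicator (A i) (u $ i)) = (indicator (\<Inter>i. {u. u $ i \<in> A i}) u :: ennreal)"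
    for u :: "real^'n"
    by (auto simp: indicator_def prod_zero_iff)
  have "emeasure std_gaussian (\<Inter>i. {u::real^'n. u $ i \<in> A i}) = (\<Prod>i\<in>UNIV. emeasure std_normal (A i))"
    using nn_integral_std_gaussian_prod[of "\<lambda>i. indicator (A i)"] unfolding ind by simp
  then show ?thesis
    by (simp add: std_gaussian.emeasure_eq_measure std_normal.emeasure_eq_measure prod_ennreal
        measure_nonneg prod_nonneg)
qed

lemma prob_std_gaussian_coordinate:
  assumes "A \<in> sets borel"
  shows "std_gaussian.prob {u::real^'n. u $ i \<in> A} = std_normal.prob A"
proof -
  have "(\<Inter>j. {u::real^'n. u $ j \<in> (if j = i then A else UNIV)}) = {u. u $ i \<in> A}"
  proof (intro equalityI subsetI)
    fix u :: "real^'n" assume "u \<in> (\<Inter>j. {u. u $ j \<in> (if j = i then A else UNIV)})"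
    then have "u $ i \<in> (if i = i then A else UNIV)" by blast
    then show "u \<in> {u. u $ i \<in> A}" by simp
  qed auto
  moreover have "(\<Prod>j\<in>UNIV. std_normal.prob (if j = i then A else UNIV)) = std_normal.prob A"
    using std_normal.prob_space by (simp add: if_distrib cong: if_cong)
  ultimately show ?thesis
    using prob_std_gaussian_box[of "\<lambda>j. if j = i then A else UNIV"] assms by simp
qed

text \<open>Box probabilities factor into marginals, which is the finite criterion for independence
  with all Borel sets as generator.\<close>

lemma indep_vars_std_gaussian:
  "std_gaussian.indep_vars (\<lambda>_. borel) (\<lambda>i u. u $ i) (UNIV :: 'n::finite set)"
proof (subst std_gaussian.indep_vars_finite[where E = "\<lambda>_. sets borel"])
  show "\<forall>A\<in>UNIV \<rightarrow> sets borel. std_gaussian.prob (\<Inter>j\<in>UNIV. (\<lambda>u::real^'n. u $ j) -` A j \<inter> space std_gaussian)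
      = (\<Prod>j\<in>UNIV. std_gaussian.prob ((\<lambda>u::real^'n. u $ j) -` A j \<inter> space std_gaussian))"
  proof
    fix A assume "A \<in> (UNIV :: 'n set) \<rightarrow> sets (borel :: real measure)"
    then have "\<And>i. A i \<in> sets borel" by auto
    then show "std_gaussian.prob (\<Inter>j\<in>UNIV. (\<lambda>u::real^'n. u $ j) -` A j \<inter> space std_gaussian)
        = (\<Prod>j\<in>UNIV. std_gaussian.prob ((\<lambda>u::real^'n. u $ j) -` A j \<inter> space std_gaussian))"
      using prob_std_gaussian_box[of A] by (simp add: vimage_def prob_std_gaussian_coordinate)
  qed
qed (auto simp: Int_stable_def sets.sigma_sets_eq[of borel, simplified])

lemma distributed_std_gaussian_coordinate:
  "distributed (std_gaussian :: (real^'n::finite) measure) lborel (\<lambda>u. u $ i) std_normal_density"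
  unfolding distributed_def
proof (intro conjI measure_eqI)
  fix A assume "A \<in> sets (distr (std_gaussian :: (real^'n) measure) lborel (\<lambda>u. u $ i))"
  then have A: "A \<in> sets borel" by simp
  then have "{u::real^'n. u $ i \<in> A} \<in> sets borel" by measurable
  then show "emeasure (distr (std_gaussian :: (real^'n) measure) lborel (\<lambda>u. u $ i)) A
      = emeasure std_normal A"
    using A prob_std_gaussian_coordinate[OF A, of i]
    by (simp add: emeasure_distr std_gaussian.emeasure_eq_measure std_normal.emeasure_eq_measure vimage_def)
qed simp_all

text \<open>A sum of independent centred Gaussians is Gaussian and the variances add, here to the
  square of \<open>norm x\<close>; dividing by \<open>norm x\<close> normalises it.\<close>

lemma distributed_std_gaussian_inner:
  fixes x :: "real^'n::finite"
  assumes "x \<noteq> 0"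
  shows "distributed std_gaussian lborel (\<lambda>u. u \<bullet> x / norm x) std_normal_density"
proof -
  \<comment> \<open>The summands must have positive standard deviation, so coordinates with
    \<open>x $ i = 0\<close> are dropped.\<close>
  define I where "I = {i. x $ i \<noteq> 0}"
  have I: "finite I" "I \<noteq> {}" using assms by (auto simp: I_def vec_eq_iff)
  have "std_gaussian.indep_vars (\<lambda>_. borel) (\<lambda>i u. u $ i) I"
    using indep_vars_std_gaussian by (rule std_gaussian.indep_vars_subset) simp
  then have indep: "std_gaussian.indep_vars (\<lambda>_. borel) (\<lambda>i u. x $ i * u $ i) I"
    by (rule std_gaussian.indep_vars_compose2) simp
  have "distributed std_gaussian lborel (\<lambda>u. 0 + x $ i * u $ i) (normal_density (0 + x $ i * 0) (\<bar>x $ i\<bar> * 1))"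
    if "i \<in> I" for i
    using that by (intro std_gaussian.normal_density_affine distributed_std_gaussian_coordinate) (auto simp: I_def)
  then have "distributed std_gaussian lborel (\<lambda>u. \<Sum>i\<in>I. x $ i * u $ i)
      (normal_density (\<Sum>i\<in>I. 0) (sqrt (\<Sum>i\<in>I. \<bar>x $ i\<bar>\<^sup>2)))"
    by (intro std_gaussian.sum_indep_normal[OF I indep]) (auto simp: I_def)
  moreover have "(\<Sum>i\<in>I. x $ i * u $ i) = u \<bullet> x" for u
    unfolding inner_vec_def I_def by (subst sum.mono_neutral_cong_right) (auto simp: mult.commute)
  moreover have "sqrt (\<Sum>i\<in>I. \<bar>x $ i\<bar>\<^sup>2) = norm x"
    unfolding norm_vec_def L2_set_def I_def
    by (subst (2) sum.mono_neutral_cong_right) auto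
  ultimately have "distributed std_gaussian lborel (\<lambda>u. u \<bullet> x) (normal_density 0 (norm x))"
    by simp
  then show ?thesis
    using assms by (subst (asm) std_gaussian.normal_standard_normal_convert) auto
qed

lemma AE_std_gaussian_inner_nonzero:
  fixes x :: "real^'n::finite"
  assumes "x \<noteq> 0"
  shows "AE u in std_gaussian. u \<bullet> x \<noteq> 0"
proof -
  have "negligible {u. x \<bullet> u = 0}"
    using assms by (intro negligible_hyperplane) simp
  then have "{u. x \<bullet> u = 0} \<in> null_sets lborel"
    by (simp add: negligible_iff_null_sets null_sets_completion_iff)
  then have "AE u in lborel. u \<notin> {u. x \<bullet> u = 0}"
    by (rule AE_not_in)
  then show ?thesis
    unfolding std_gaussian_def by (subst AE_density) (auto simp: inner_commute)
qed

text \<open>The expectation of \<open>tpow (2 * m)\<close> under the standard normal distribution.\<close>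

definition half_moment :: "nat \<Rightarrow> real" where
  "half_moment m = 2 ^ m / 2 * Gamma (real m + 1 / 2) / sqrt pi"

lemma half_moment_0: "half_moment 0 = 1 / 2"
  by (simp add: half_moment_def Gamma_one_half_real)

lemma half_moment_Suc: "half_moment (Suc m) = (2 * real m + 1) * half_moment m"
proof -
  have "Gamma (real m + 1 / 2 + 1) = (real m + 1 / 2) * Gamma (real m + 1 / 2)"
    by (rule Gamma_plus1) (auto elim!: nonpos_Ints_cases)
  then show ?thesis
    by (simp add: half_moment_def field_simps)
qed

text \<open>The quotient of factorials is the double factorial of \<open>2 * m - 1\<close>, the full
  even moment of the standard normal law; both sides satisfy the same recursion.\<close>

lemma half_moment_eq_fact: "half_moment m = fact (2 * m) / (2 ^ m * fact m) / 2"
proof (induction m)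
  case (Suc m)
  have "fact (2 * Suc m) = (2 * real m + 2) * (2 * real m + 1) * fact (2 * m)"
    by (simp add: algebra_simps)
  also have "\<dots> / (2 ^ Suc m * fact (Suc m)) / 2 = (2 * real m + 1) * (fact (2 * m) / (2 ^ m * fact m) / 2)"
    by (simp add: divide_simps)
  finally show ?case by (simp add: half_moment_Suc Suc)
qed (simp add: half_moment_0)

lemma half_moment_nonneg: "0 \<le> half_moment m"
  by (simp add: half_moment_eq_fact)

text \<open>An even power splits into its restrictions to the two half-lines, and reflection shows
  that these contribute equally.\<close>

lemma nn_integral_std_normal_tpow:
  "(\<integral>\<^sup>+t. ennreal (tpow (2 * m) t) \<partial>std_normal) = ennreal (half_moment m)"
proof -
  let ?I = "\<integral>\<^sup>+t. ennreal (std_normal_density t * tpow (2 * m) t) \<partial>lborel"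
  have "(\<integral>\<^sup>+t. ennreal (std_normal_density t * t ^ (2 * m)) \<partial>lborel)
      = (\<integral>\<^sup>+t. ennreal (std_normal_density t * tpow (2 * m) t)
          + ennreal (std_normal_density (- t) * tpow (2 * m) (- t)) \<partial>lborel)"
  \<comment> \<open>At \<open>t = 0\<close> and \<open>m = 0\<close> the left side is positive while
    both one-sided powers vanish, so equality holds only almost everywhere.\<close>
  proof (rule nn_integral_cong_AE)
    show "AE t in lborel. ennreal (std_normal_density t * t ^ (2 * m))
        = ennreal (std_normal_density t * tpow (2 * m) t)
          + ennreal (std_normal_density (- t) * tpow (2 * m) (- t))"
      using AE_lborel_singleton[of "0::real"]
      by eventually_elim (auto simp: tpow_def normal_density_def)
  qed
  also have "\<dots> = ?I + (\<integral>\<^sup>+t. ennreal (std_normal_density (- t) * tpow (2 * m) (- t)) \<partial>lborel)"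
    by (rule nn_integral_add) simp_all
  also have "(\<integral>\<^sup>+t. ennreal (std_normal_density (- t) * tpow (2 * m) (- t)) \<partial>lborel) = ?I"
    using nn_integral_real_affine[of "\<lambda>t. ennreal (std_normal_density t * tpow (2 * m) t)" "-1" 0] by simp
  finally have 1: "?I + ?I = ennreal (2 * half_moment m)"
    using nn_integral_eq_integral[OF integrable_std_normal_moment[of "2 * m"]]
      integral_std_normal_moment_even[of m]
    by (simp add: half_moment_eq_fact power_mult)
  have "2 * ?I = ennreal (2 * half_moment m)"
    unfolding 1[symmetric] by (rule mult_2)
  also have "\<dots> = 2 * ennreal (half_moment m)"
    by (simp add: ennreal_mult half_moment_nonneg)
  finally have "?I = ennreal (half_moment m)"
    by (simp add: ennreal_mult_cancel_left)
  then show ?thesis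
    by (simp add: nn_integral_density ennreal_mult)
qed

lemma nn_integral_std_gaussian_tpow:
  fixes x :: "real^'n::finite"
  assumes "x \<noteq> 0"
  shows "(\<integral>\<^sup>+u. ennreal (tpow (2 * m) (u \<bullet> x)) \<partial>std_gaussian) = ennreal (norm x ^ (2 * m) * half_moment m)"
proof -
  have "tpow (2 * m) (u \<bullet> x) = norm x ^ (2 * m) * tpow (2 * m) (u \<bullet> x / norm x)" for u
    using assms tpow_scale[of "norm x" "2 * m" "u \<bullet> x / norm x"] by simp
  then have "(\<integral>\<^sup>+u. ennreal (tpow (2 * m) (u \<bullet> x)) \<partial>std_gaussian)
      = (\<integral>\<^sup>+u. ennreal (norm x ^ (2 * m)) * ennreal (tpow (2 * m) (u \<bullet> x / norm x)) \<partial>std_gaussian)"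
    by (simp add: ennreal_mult)
  also have "\<dots> = (\<integral>\<^sup>+t. std_normal_density t * (ennreal (norm x ^ (2 * m)) * ennreal (tpow (2 * m) t)) \<partial>lborel)"
    by (rule distributed_nn_integral[OF distributed_std_gaussian_inner[OF assms], symmetric]) simp
  also have "\<dots> = ennreal (norm x ^ (2 * m)) * (\<integral>\<^sup>+t. ennreal (tpow (2 * m) t) \<partial>std_normal)"
    by (simp add: nn_integral_density nn_integral_cmult[symmetric] mult_ac)
  finally show ?thesis
    by (simp add: nn_integral_std_normal_tpow ennreal_mult half_moment_nonneg)
qed

section \<open>Norm factors in Gaussian moments, by dilation\<close>

lemma prod_std_normal_density:
  fixes u :: "real^'n::finite"
  shows "(\<Prod>i\<in>UNIV. std_normal_density (u $ i)) = (1 / sqrt (2 * pi)) ^ CARD('n) * exp (- (u \<bullet> u) / 2)"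
  by (simp only: std_normal_density_def prod.distrib prod_constant exp_sum[OF finite, symmetric])
    (simp add: inner_vec_def power2_eq_square sum_divide_distrib sum_negf)

lemma nn_integral_lborel_scale:
  fixes f :: "real^'n::finite \<Rightarrow> ennreal"
  assumes [measurable]: "f \<in> borel_measurable borel" and "0 < c"
  shows "(\<integral>\<^sup>+u. f u \<partial>lborel) = ennreal (c ^ CARD('n)) * (\<integral>\<^sup>+u. f (c *\<^sub>R u) \<partial>lborel)"
  using \<open>0 < c\<close> by (subst lborel_affine[of c 0])
    (simp_all add: nn_integral_density nn_integral_distr nn_integral_cmult ennreal_power)

lemma nn_integral_inverse_power_atLeast_one:
  assumes "0 < q"
  shows "(\<integral>\<^sup>+t. ennreal (1 / t ^ Suc q) * indicator {1..} t \<partial>lborel) = ennreal (1 / real q)"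
proof -
  have lim: "((\<lambda>t::real. - 1 / (real q * t ^ q)) \<longlongrightarrow> 0) at_top"
    using assms by real_asymp
  have "(\<integral>\<^sup>+t. ennreal (1 / t ^ Suc q) * indicator {1..} t \<partial>lborel) = ennreal (0 - (- 1 / (real q * 1 ^ q)))"
  proof (rule nn_integral_FTC_atLeast[OF _ _ _ lim])
    fix t :: real assume t: "1 \<le> t"
    obtain k where k: "q = Suc k" using assms by (cases q) auto
    have pw: "((\<lambda>t. t ^ q) has_real_derivative real q * t ^ k) (at t)"
      using DERIV_pow[of q t UNIV] k by simp
    have "((\<lambda>t. (- 1 / real q) * inverse (t ^ q)) has_real_derivative
        (- 1 / real q) * (- (inverse (t ^ q) * (real q * t ^ k) * inverse (t ^ q)))) (at t)"
      by (rule DERIV_cmult[OF DERIV_inverse'[OF pw]]) (use t in auto)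
    also have "(- 1 / real q) * (- (inverse (t ^ q) * (real q * t ^ k) * inverse (t ^ q))) = 1 / t ^ Suc q"
    proof -
      have "t ^ q = t * t ^ k" by (simp add: k)
      then show ?thesis
        using t assms by (simp add: field_simps)
    qed
    finally show "((\<lambda>t. - 1 / (real q * t ^ q)) has_real_derivative 1 / t ^ Suc q) (at t)"
      by (simp add: divide_inverse mult.assoc)
  qed auto
  then show ?thesis by simp
qed

lemma nn_integral_scaled_gaussian:
  fixes r \<kappa> :: real
  assumes "0 < r" "0 \<le> \<kappa>"
  shows "(\<integral>\<^sup>+t. ennreal (\<kappa> * (t * r * exp (- (t * t * r) / 2))) * indicator {1..} t \<partial>lborel) = ennreal (\<kappa> * exp (- r / 2))"
proof -
  have lim: "((\<lambda>t. - \<kappa> * exp (- (t * t * r) / 2)) \<longlongrightarrow> - \<kappa> * 0) at_top"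
    using assms(1) by (intro tendsto_mult tendsto_const) real_asymp
  have "(\<integral>\<^sup>+t. ennreal (\<kappa> * (t * r * exp (- (t * t * r) / 2))) * indicator {1..} t \<partial>lborel)
      = ennreal (- \<kappa> * 0 - (- \<kappa> * exp (- (1 * 1 * r) / 2)))"
    by (rule nn_integral_FTC_atLeast[OF _ _ _ lim])
      (use assms in \<open>auto intro!: derivative_eq_intros\<close>)
  then show ?thesis by simp
qed

text \<open>Writing the Gaussian weight as an integral over its dilations by \<open>t \<ge> 1\<close> and exchanging
  the integrals, homogeneity turns the inner integral into a power of \<open>t\<close>.\<close>

lemma nn_integral_std_gaussian_inner_self:
  fixes h :: "real^'n::finite \<Rightarrow> real"
  assumes [measurable]: "h \<in> borel_measurable borel"
    and nonneg: "\<And>u. 0 \<le> h u"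
    and hom: "\<And>t u. 0 < t \<Longrightarrow> h (t *\<^sub>R u) = t ^ p * h u"
  shows "(\<integral>\<^sup>+u. ennreal ((u \<bullet> u) * h u) \<partial>std_gaussian)
     = ennreal (real (p + CARD('n))) * (\<integral>\<^sup>+u. ennreal (h u) \<partial>std_gaussian)"
proof -
  define \<kappa> where "\<kappa> = (1 / sqrt (2 * pi)) ^ CARD('n)"
  define q where "q = p + CARD('n)"
  have \<kappa>: "0 \<le> \<kappa>" by (simp add: \<kappa>_def)
  have q: "0 < q" by (simp add: q_def)
  have G: "(\<integral>\<^sup>+u. ennreal (f u) \<partial>std_gaussian) = (\<integral>\<^sup>+u. ennreal (\<kappa> * exp (- (u \<bullet> u) / 2) * f u) \<partial>lborel)"
    if [measurable]: "f \<in> borel_measurable borel" for f :: "real^'n \<Rightarrow> real"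
    unfolding std_gaussian_def prod_std_normal_density \<kappa>_def[symmetric]
    using \<kappa> by (subst nn_integral_density) (auto simp: ennreal_mult')
  define J where "J = (\<integral>\<^sup>+u. ennreal (\<kappa> * exp (- (u \<bullet> u) / 2) * ((u \<bullet> u) * h u)) \<partial>lborel)"
  \<comment> \<open>This is minus the derivative in \<open>t\<close> of the Gaussian weight at
    \<open>t *\<^sub>R u\<close>, so its integral over \<open>t \<ge> 1\<close> is the weight at
    \<open>u\<close> when \<open>u \<noteq> 0\<close>.\<close>
  define w where "w = (\<lambda>t (u::real^'n). \<kappa> * (t * (u \<bullet> u) * exp (- (t * t * (u \<bullet> u)) / 2)))"
  have [measurable]: "(\<lambda>(t, u). w t u) \<in> borel_measurable (lborel \<Otimes>\<^sub>M lborel)"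
    unfolding w_def by measurable
  have ennreal3: "ennreal a * (ennreal b * (ennreal c * X)) = ennreal (a * (b * c)) * X"
    if "0 \<le> a" "0 \<le> b" "0 \<le> c" for a b c X
    using that by (simp add: ennreal_mult mult.assoc)
  have wnn: "0 \<le> w t u" if "0 \<le> t" for t u
    using that \<kappa> by (simp add: w_def)
  \<comment> \<open>Replacing \<open>u\<close> by \<open>t *\<^sub>R u\<close> gives
    \<open>t ^ CARD('n)\<close> from the Jacobian, \<open>t ^ p\<close> from \<open>h\<close> and
    \<open>t ^ 2\<close> from the inner product; one factor \<open>t\<close> is absorbed in
    \<open>w\<close>, which leaves the exponent \<open>Suc q\<close>.\<close>
  have scaled: "(\<integral>\<^sup>+u. ennreal (w t u * h u) \<partial>lborel) = ennreal (1 / t ^ Suc q) * J" if t: "1 \<le> t" for t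
  proof -
    have "J = ennreal (t ^ CARD('n)) * (\<integral>\<^sup>+u. ennreal (\<kappa> * exp (- ((t *\<^sub>R u) \<bullet> (t *\<^sub>R u)) / 2)
        * (((t *\<^sub>R u) \<bullet> (t *\<^sub>R u)) * h (t *\<^sub>R u))) \<partial>lborel)"
      unfolding J_def using t by (intro nn_integral_lborel_scale) auto
    also have "(\<integral>\<^sup>+u. ennreal (\<kappa> * exp (- ((t *\<^sub>R u) \<bullet> (t *\<^sub>R u)) / 2)
        * (((t *\<^sub>R u) \<bullet> (t *\<^sub>R u)) * h (t *\<^sub>R u))) \<partial>lborel)
        = (\<integral>\<^sup>+u. ennreal (t ^ Suc p) * ennreal (w t u * h u) \<partial>lborel)"
      using t by (intro nn_integral_cong, subst ennreal_mult'[symmetric])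
        (simp_all add: w_def hom mult_ac)
    also have "\<dots> = ennreal (t ^ Suc p) * (\<integral>\<^sup>+u. ennreal (w t u * h u) \<partial>lborel)"
      by (rule nn_integral_cmult) simp
    finally have "ennreal (1 / t ^ Suc q) * J
        = ennreal (1 / t ^ Suc q * (t ^ CARD('n) * t ^ Suc p)) * (\<integral>\<^sup>+u. ennreal (w t u * h u) \<partial>lborel)"
      using t by (subst ennreal3[symmetric]) auto
    also have "1 / t ^ Suc q * (t ^ CARD('n) * t ^ Suc p) = 1"
      using t by (simp add: q_def power_add)
    finally show ?thesis by simp
  qed
  have "(\<integral>\<^sup>+u. ennreal (h u) \<partial>std_gaussian) = (\<integral>\<^sup>+u. ennreal (\<kappa> * exp (- (u \<bullet> u) / 2)) * ennreal (h u) \<partial>lborel)"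
    using \<kappa> nonneg by (subst G) (auto simp: ennreal_mult)
  also have "\<dots> = (\<integral>\<^sup>+u. (\<integral>\<^sup>+t. ennreal (w t u) * indicator {1..} t \<partial>lborel) * ennreal (h u) \<partial>lborel)"
  \<comment> \<open>The point \<open>u = 0\<close> is excluded: there \<open>w\<close> vanishes
    while the Gaussian weight does not.\<close>
  proof (rule nn_integral_cong_AE)
    show "AE u in lborel. ennreal (\<kappa> * exp (- (u \<bullet> u) / 2)) * ennreal (h u)
        = (\<integral>\<^sup>+t. ennreal (w t u) * indicator {1..} t \<partial>lborel) * ennreal (h u)"
      using AE_lborel_singleton[of "0::real^'n"]
    proof eventually_elim
      case (elim u)
      then show ?case
        using nn_integral_scaled_gaussian[of "u \<bullet> u" \<kappa>] \<kappa> by (simp add: w_def)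
    qed
  qed
  also have "\<dots> = (\<integral>\<^sup>+u. (\<integral>\<^sup>+t. ennreal (w t u) * indicator {1..} t * ennreal (h u) \<partial>lborel) \<partial>lborel)"
    by (intro nn_integral_cong nn_integral_multc[symmetric]) (simp add: w_def)
  also have "\<dots> = (\<integral>\<^sup>+t. (\<integral>\<^sup>+u. ennreal (w t u) * indicator {1..} t * ennreal (h u) \<partial>lborel) \<partial>lborel)"
    by (rule lborel_pair.Fubini') measurable
  also have "\<dots> = (\<integral>\<^sup>+t. ennreal (1 / t ^ Suc q) * indicator {1..} t * J \<partial>lborel)"
  proof (rule nn_integral_cong)
    fix t :: real
    show "(\<integral>\<^sup>+u. ennreal (w t u) * indicator {1..} t * ennreal (h u) \<partial>lborel)
        = ennreal (1 / t ^ Suc q) * indicator {1..} t * J"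
      using scaled[of t] wnn[of t] nonneg by (cases "1 \<le> t") (simp_all add: ennreal_mult)
  qed
  also have "\<dots> = ennreal (1 / real q) * J"
    by (subst nn_integral_multc) (auto simp: nn_integral_inverse_power_atLeast_one[OF q] simp del: power_Suc)
  finally have eq: "(\<integral>\<^sup>+u. ennreal (h u) \<partial>std_gaussian) = ennreal (1 / real q) * J" .
  have "ennreal (real q) * (\<integral>\<^sup>+u. ennreal (h u) \<partial>std_gaussian) = ennreal (real q * (1 / real q)) * J"
    unfolding eq by (subst ennreal_mult) (simp_all add: mult.assoc)
  also have "\<dots> = (\<integral>\<^sup>+u. ennreal ((u \<bullet> u) * h u) \<partial>std_gaussian)"
    using q by (subst G) (auto simp: J_def)
  finally show ?thesis by (simp add: q_def)
qed

lemma nn_integral_std_gaussian_norm2_tpow: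
  fixes x :: "real^'n::finite"
  assumes "x \<noteq> 0"
  shows "(\<integral>\<^sup>+u. ennreal ((u \<bullet> u) * tpow (2 * m) (u \<bullet> x)) \<partial>std_gaussian)
      = ennreal ((2 * real m + CARD('n)) * (norm x ^ (2 * m) * half_moment m))"
  by (subst nn_integral_std_gaussian_inner_self[where p = "2 * m"])
    (auto simp: tpow_scale nn_integral_std_gaussian_tpow[OF assms] ennreal_mult half_moment_nonneg)

text \<open>The dilation identity is used once more, now for
  \<open>(u \<bullet> u) * tpow (2 * m) (u \<bullet> x)\<close>, which is homogeneous of degree
  \<open>2 * m + 2\<close>.\<close>

lemma nn_integral_std_gaussian_norm4_tpow:
  fixes x :: "real^'n::finite"
  assumes "x \<noteq> 0"
  shows "(\<integral>\<^sup>+u. ennreal ((u \<bullet> u)\<^sup>2 * tpow (2 * m) (u \<bullet> x)) \<partial>std_gaussian)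
      = ennreal ((2 * real m + 2 + CARD('n)) * ((2 * real m + CARD('n)) * (norm x ^ (2 * m) * half_moment m)))"
proof -
  have "(\<integral>\<^sup>+u. ennreal ((u \<bullet> u) * ((u \<bullet> u) * tpow (2 * m) (u \<bullet> x))) \<partial>std_gaussian)
      = ennreal (real (2 * m + 2 + CARD('n)))
          * (\<integral>\<^sup>+u. ennreal ((u \<bullet> u) * tpow (2 * m) (u \<bullet> x)) \<partial>std_gaussian)"
    by (rule nn_integral_std_gaussian_inner_self) (auto simp: tpow_scale power2_eq_square power_add)
  also have "\<dots> = ennreal ((2 * real m + 2 + CARD('n)) * ((2 * real m + CARD('n)) * (norm x ^ (2 * m) * half_moment m)))"
    unfolding nn_integral_std_gaussian_norm2_tpow[OF assms]
    by (subst ennreal_mult[symmetric]) (simp_all add: half_moment_nonneg)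
  finally show ?thesis by (simp add: power2_eq_square mult.assoc)
qed

section \<open>Diagonal entries of the kernel matrix\<close>

text \<open>This is the product rule: the Laplacian of \<open>g\<close> times the coordinate
  \<open>z $ k\<close> is \<open>z $ k\<close> times the Laplacian of \<open>g\<close> plus twice
  the \<open>k\<close>-th partial derivative of \<open>g\<close>.\<close>

lemma laplacian_weighted_tpow:
  assumes "0 < n \<or> u \<bullet> x \<noteq> 0"
  shows "laplacian (\<lambda>z. deriv (repu (n + 3)) (u \<bullet> z) * z $ k) x
     = (real n + 3) * (real n + 2)
        * ((real n + 1) * tpow n (u \<bullet> x) * (u \<bullet> u) * x $ k + 2 * tpow (n + 1) (u \<bullet> x) * u $ k)"
proof -
  have ax: "(\<Sum>i\<in>UNIV. u $ i * axis i 1 $ k) = u $ k"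
    by (simp add: axis_def if_distrib cong: if_cong)
  have sum: "(\<Sum>i\<in>UNIV. a * (b * (u $ i * u $ i) * c + e * u $ i * axis i 1 $ k))
      = a * (b * (u \<bullet> u) * c + e * u $ k)" for a b c e
    unfolding ax[symmetric] inner_vec_def
    by (simp add: sum_distrib_left sum_distrib_right sum.distrib distrib_left mult_ac)
  have "partial_deriv i (partial_deriv i (\<lambda>z. (real n + 3) * tpow (n + 2) (u \<bullet> z) * z $ k)) x
     = (real n + 3) * (real n + 2)
        * ((real n + 1) * tpow n (u \<bullet> x) * (u $ i * u $ i) * x $ k
           + 2 * tpow (n + 1) (u \<bullet> x) * u $ i * axis i 1 $ k)" for i
    using assms by (intro partial_deriv2_weighted_tpow) auto
  then show ?thesis
    unfolding laplacian_def deriv_repu by (simp only: sum)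
qed

text \<open>On the hyperplane the value depends on \<open>u\<close> only through the set of its
  vanishing coordinates, and is therefore a Borel function of \<open>u\<close>.\<close>

lemma laplacian_weighted_tpow_hyperplane:
  assumes "n = 0" "u \<bullet> x = 0"
  shows "laplacian (\<lambda>z. deriv (repu (n + 3)) (u \<bullet> z) * z $ k) x
     = (\<Sum>i\<in>UNIV. if u $ i = 0 \<or> x $ k = 0 then 0 else (SOME D. False))"
  unfolding laplacian_def deriv_repu
proof (intro sum.cong refl)
  fix i
  show "partial_deriv i (partial_deriv i (\<lambda>z. (real n + 3) * tpow (n + 2) (u \<bullet> z) * z $ k)) x
      = (if u $ i = 0 \<or> x $ k = 0 then 0 else (SOME D. False))"
  proof (cases "u $ i = 0 \<or> x $ k = 0")
    case True
    then show ?thesis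
      using assms by (subst partial_deriv2_weighted_tpow) auto
  next
    case False
    then show ?thesis
      using assms by (subst partial_deriv2_weighted_tpow_kink) auto
  qed
qed

lemma laplacian_weighted_tpow_measurable [measurable]:
  "(\<lambda>u. laplacian (\<lambda>z. deriv (repu (n + 3)) (u \<bullet> z) * z $ k) x) \<in> borel_measurable borel"
proof -
  have "(\<lambda>u. laplacian (\<lambda>z. deriv (repu (n + 3)) (u \<bullet> z) * z $ k) x)
    = (\<lambda>u. if 0 < n \<or> u \<bullet> x \<noteq> 0
        then (real n + 3) * (real n + 2)
          * ((real n + 1) * tpow n (u \<bullet> x) * (u \<bullet> u) * x $ k + 2 * tpow (n + 1) (u \<bullet> x) * u $ k)
        else (\<Sum>i\<in>UNIV. if u $ i = 0 \<or> x $ k = 0 then 0 else (SOME D. False)))"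
    (is "_ = (\<lambda>u. if ?P u then ?f u else ?g u)")
  proof
    fix u
    show "laplacian (\<lambda>z. deriv (repu (n + 3)) (u \<bullet> z) * z $ k) x = (if ?P u then ?f u else ?g u)"
    proof (cases "?P u")
      case True
      then show ?thesis by (simp only: laplacian_weighted_tpow if_True)
    next
      case False
      then have "n = 0" "u \<bullet> x = 0" by auto
      then show ?thesis
        using False by (simp only: laplacian_weighted_tpow_hyperplane if_False)
    qed
  qed
  then show ?thesis by simp
qed

text \<open>The squared norm of the feature vector with \<open>CARD('n) + 1\<close> components: the
  integrand of a diagonal entry.\<close>

definition feature_energy :: "nat \<Rightarrow> 'n::finite operator \<Rightarrow> real^'n \<Rightarrow> real^'n \<Rightarrow> real" where
  "feature_energy s A x u = (A (\<lambda>z. repu s (u \<bullet> z)) x)\<^sup>2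
     + (\<Sum>k\<in>UNIV. (A (\<lambda>z. deriv (repu s) (u \<bullet> z) * z $ k) x)\<^sup>2)"

lemma dntk_diagonal: "dntk s A x A x = (\<integral>u. feature_energy s A x u \<partial>std_gaussian)"
  by (simp add: dntk_def feature_energy_def power2_eq_square)

lemma dntk_commute: "dntk s A x B y = dntk s B y A x"
  by (simp add: dntk_def mult.commute)

text \<open>The integrand of \<open>dntk\<close> need not be integrable, in which case its integral is \<open>0\<close>.\<close>

lemma abs_dntk_le:
  fixes x y :: "real^'n::finite"
  assumes x: "integrable std_gaussian (feature_energy s A x)"
    and y: "integrable std_gaussian (feature_energy s B y)"
  shows "\<bar>dntk s A x B y\<bar> \<le> (dntk s A x A x + dntk s B y B y) / 2"
proof -
  let ?f = "\<lambda>u. A (\<lambda>z. repu s (u \<bullet> z)) x * B (\<lambda>z. repu s (u \<bullet> z)) y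
        + (\<Sum>k\<in>UNIV. A (\<lambda>z. deriv (repu s) (u \<bullet> z) * z $ k) x
                    * B (\<lambda>z. deriv (repu s) (u \<bullet> z) * z $ k) y)"
  let ?g = "\<lambda>u. (feature_energy s A x u + feature_energy s B y u) / 2"
  have amgm: "\<bar>a * b\<bar> \<le> (a\<^sup>2 + b\<^sup>2) / 2" for a b :: real
    using sum_squares_bound[of "\<bar>a\<bar>" "\<bar>b\<bar>"] by (simp add: abs_mult)
  have le: "\<bar>?f u\<bar> \<le> ?g u" for u
  proof -
    have "\<bar>?f u\<bar> \<le> \<bar>A (\<lambda>z. repu s (u \<bullet> z)) x * B (\<lambda>z. repu s (u \<bullet> z)) y\<bar>
        + (\<Sum>k\<in>UNIV. \<bar>A (\<lambda>z. deriv (repu s) (u \<bullet> z) * z $ k) x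
                    * B (\<lambda>z. deriv (repu s) (u \<bullet> z) * z $ k) y\<bar>)"
      by (rule order_trans[OF abs_triangle_ineq]) (simp add: sum_abs)
    also have "\<dots> \<le> ((A (\<lambda>z. repu s (u \<bullet> z)) x)\<^sup>2 + (B (\<lambda>z. repu s (u \<bullet> z)) y)\<^sup>2) / 2
        + (\<Sum>k\<in>UNIV. ((A (\<lambda>z. deriv (repu s) (u \<bullet> z) * z $ k) x)\<^sup>2
                    + (B (\<lambda>z. deriv (repu s) (u \<bullet> z) * z $ k) y)\<^sup>2) / 2)"
      by (intro add_mono sum_mono amgm)
    also have "\<dots> = ?g u"
      by (simp add: feature_energy_def sum.distrib sum_divide_distrib[symmetric] add_divide_distrib)
    finally show ?thesis .
  qed
  have g: "integrable std_gaussian ?g" using x y by simp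
  have "\<bar>dntk s A x B y\<bar> \<le> (\<integral>u. ?g u \<partial>std_gaussian)"
  proof (cases "integrable std_gaussian ?f")
    case True
    then show ?thesis
      unfolding dntk_def using integral_abs_bound_integral[OF True g] le by simp
  next
    case False
    have "0 \<le> ?g u" for u using le[of u] by linarith
    then show ?thesis
      unfolding dntk_def not_integrable_integral_eq[OF False] by simp
  qed
  also have "\<dots> = (dntk s A x A x + dntk s B y B y) / 2"
    using x y by (simp add: dntk_diagonal)
  finally show ?thesis .
qed

lemma has_bochner_integral_std_gaussian_tpow:
  fixes x :: "real^'n::finite"
  assumes "x \<noteq> 0"
  shows "has_bochner_integral std_gaussian (\<lambda>u. tpow (2 * m) (u \<bullet> x)) (norm x ^ (2 * m) * half_moment m)"
    and "has_bochner_integral std_gaussian (\<lambda>u. (u \<bullet> u) * tpow (2 * m) (u \<bullet> x))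
      ((2 * real m + CARD('n)) * (norm x ^ (2 * m) * half_moment m))"
    and "has_bochner_integral std_gaussian (\<lambda>u. (u \<bullet> u)\<^sup>2 * tpow (2 * m) (u \<bullet> x))
      ((2 * real m + 2 + CARD('n)) * ((2 * real m + CARD('n)) * (norm x ^ (2 * m) * half_moment m)))"
  by (rule has_bochner_integral_nn_integral; use nn_integral_std_gaussian_tpow[OF assms]
      nn_integral_std_gaussian_norm2_tpow[OF assms] nn_integral_std_gaussian_norm4_tpow[OF assms]
      in \<open>auto simp: half_moment_nonneg\<close>)+

text \<open>The factor left in an interior diagonal entry after the square of
  \<open>(n + 3) * (n + 2) * norm x ^ (n + 1)\<close> is taken out. Its summands come from the
  Laplacian of the activation, from the squared third-derivative terms, and from the cross terms
  joined with the squared second-derivative terms.\<close>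

definition interior_moment :: "nat \<Rightarrow> nat \<Rightarrow> real" where
  "interior_moment n d = (2 * real n + 4 + d) * ((2 * real n + 2 + d) * half_moment (n + 1))
     + (real n + 1)\<^sup>2 * ((2 * real n + 2 + d) * ((2 * real n + d) * half_moment n))
     + 4 * (real n + 2) * ((2 * real n + 2 + d) * half_moment (n + 1))"

text \<open>Up to a constant, the features with coordinate index form a combination of
  \<open>x\<close> and \<open>u\<close>, whose squared norm is expanded. The factor
  \<open>u \<bullet> x\<close> of the cross term raises the exponent of \<open>tpow\<close>, so its
  coefficient \<open>4 * (n + 1)\<close> merges with 4 into \<open>4 * (n + 2)\<close>.\<close>

lemma feature_energy_laplacian:
  assumes "0 < n \<or> u \<bullet> x \<noteq> 0"
  shows "feature_energy (n + 3) laplacian x u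
     = ((real n + 3) * (real n + 2))\<^sup>2
        * ((u \<bullet> u)\<^sup>2 * tpow (2 * (n + 1)) (u \<bullet> x)
           + (real n + 1)\<^sup>2 * (x \<bullet> x) * ((u \<bullet> u)\<^sup>2 * tpow (2 * n) (u \<bullet> x))
           + 4 * (real n + 2) * ((u \<bullet> u) * tpow (2 * (n + 1)) (u \<bullet> x)))"
proof -
  let ?c = "(real n + 3) * (real n + 2)"
  let ?p = "(real n + 1) * tpow n (u \<bullet> x) * (u \<bullet> u)" and ?q = "2 * tpow (n + 1) (u \<bullet> x)"
  have "(\<Sum>k\<in>UNIV. (?p * x $ k + ?q * u $ k)\<^sup>2) = (?p *\<^sub>R x + ?q *\<^sub>R u) \<bullet> (?p *\<^sub>R x + ?q *\<^sub>R u)"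
    by (simp add: inner_vec_def power2_eq_square)
  also have "\<dots> = ?p\<^sup>2 * (x \<bullet> x) + 2 * ?p * ?q * (u \<bullet> x) + ?q\<^sup>2 * (u \<bullet> u)"
    by (simp add: inner_add_left inner_add_right inner_commute[of x u] power2_eq_square algebra_simps)
  finally have sum: "(\<Sum>k\<in>UNIV. (?p * x $ k + ?q * u $ k)\<^sup>2)
      = ?p\<^sup>2 * (x \<bullet> x) + 2 * ?p * ?q * (u \<bullet> x) + ?q\<^sup>2 * (u \<bullet> u)" .
  have t: "tpow n (u \<bullet> x) * tpow n (u \<bullet> x) = tpow (2 * n) (u \<bullet> x)"
      "tpow (n + 1) (u \<bullet> x) * tpow (n + 1) (u \<bullet> x) = tpow (2 * (n + 1)) (u \<bullet> x)"
      "tpow n (u \<bullet> x) * tpow (n + 1) (u \<bullet> x) * (u \<bullet> x) = tpow (2 * (n + 1)) (u \<bullet> x)"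
    by (simp_all add: tpow_def mult_2 power_add power2_eq_square)
  have "feature_energy (n + 3) laplacian x u
      = (?c * (u \<bullet> u) * tpow (n + 1) (u \<bullet> x))\<^sup>2 + ?c\<^sup>2 * (\<Sum>k\<in>UNIV. (?p * x $ k + ?q * u $ k)\<^sup>2)"
    unfolding feature_energy_def laplacian_repu laplacian_weighted_tpow[OF assms]
    by (simp only: power_mult_distrib sum_distrib_left)
  also have "\<dots> = ?c\<^sup>2 * ((u \<bullet> u)\<^sup>2 * (tpow (n + 1) (u \<bullet> x) * tpow (n + 1) (u \<bullet> x))
           + (real n + 1)\<^sup>2 * (x \<bullet> x) * ((u \<bullet> u)\<^sup>2 * (tpow n (u \<bullet> x) * tpow n (u \<bullet> x)))
           + 4 * (real n + 1) * ((u \<bullet> u) * (tpow n (u \<bullet> x) * tpow (n + 1) (u \<bullet> x) * (u \<bullet> x)))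
           + 4 * ((u \<bullet> u) * (tpow (n + 1) (u \<bullet> x) * tpow (n + 1) (u \<bullet> x))))"
    unfolding sum unfolding power2_eq_square by algebra
  finally show ?thesis
    unfolding t by (simp add: algebra_simps)
qed

lemma feature_energy_laplacian_measurable [measurable]:
  "feature_energy (n + 3) laplacian x \<in> borel_measurable borel"
  unfolding feature_energy_def[abs_def] laplacian_repu by measurable

lemma feature_energy_laplacian_zero: "feature_energy (n + 3) laplacian 0 u = 0"
proof (cases "0 < n")
  case True
  then show ?thesis
    unfolding feature_energy_def laplacian_repu by (simp add: laplacian_weighted_tpow)
next
  case False
  then have "laplacian (\<lambda>z. deriv (repu (n + 3)) (u \<bullet> z) * z $ k) 0 = 0" for k
    by (subst laplacian_weighted_tpow_hyperplane) auto
  then show ?thesis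
    unfolding feature_energy_def laplacian_repu by simp
qed

lemma has_bochner_integral_feature_energy_laplacian:
  fixes x :: "real^'n::finite"
  shows "has_bochner_integral std_gaussian (feature_energy (n + 3) laplacian x)
     (((real n + 3) * (real n + 2) * norm x ^ (n + 1))\<^sup>2 * interior_moment n CARD('n))"
proof (cases "x = 0")
  case True
  then have "feature_energy (n + 3) laplacian x = (\<lambda>_. 0)"
    by (simp add: fun_eq_iff feature_energy_laplacian_zero del: One_nat_def)
  then show ?thesis using True by (simp add: power_0_left has_bochner_integral_zero)
next
  case False
  let ?E = "\<lambda>u. ((real n + 3) * (real n + 2))\<^sup>2
        * ((u \<bullet> u)\<^sup>2 * tpow (2 * (n + 1)) (u \<bullet> x)
           + (real n + 1)\<^sup>2 * (x \<bullet> x) * ((u \<bullet> u)\<^sup>2 * tpow (2 * n) (u \<bullet> x))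
           + 4 * (real n + 2) * ((u \<bullet> u) * tpow (2 * (n + 1)) (u \<bullet> x)))"
  let ?d = "real CARD('n)" and ?r = "norm x"
  have "has_bochner_integral std_gaussian ?E (((real n + 3) * (real n + 2))\<^sup>2
        * ((2 * real (n + 1) + 2 + ?d) * ((2 * real (n + 1) + ?d) * (?r ^ (2 * (n + 1)) * half_moment (n + 1)))
           + (real n + 1)\<^sup>2 * (x \<bullet> x) * ((2 * real n + 2 + ?d) * ((2 * real n + ?d) * (?r ^ (2 * n) * half_moment n)))
           + 4 * (real n + 2) * ((2 * real (n + 1) + ?d) * (?r ^ (2 * (n + 1)) * half_moment (n + 1)))))"
    by (intro has_bochner_integral_mult_right has_bochner_integral_add
        has_bochner_integral_std_gaussian_tpow False)
  also have "((real n + 3) * (real n + 2))\<^sup>2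
        * ((2 * real (n + 1) + 2 + ?d) * ((2 * real (n + 1) + ?d) * (?r ^ (2 * (n + 1)) * half_moment (n + 1)))
           + (real n + 1)\<^sup>2 * (x \<bullet> x) * ((2 * real n + 2 + ?d) * ((2 * real n + ?d) * (?r ^ (2 * n) * half_moment n)))
           + 4 * (real n + 2) * ((2 * real (n + 1) + ?d) * (?r ^ (2 * (n + 1)) * half_moment (n + 1))))
      = ((real n + 3) * (real n + 2) * norm x ^ (n + 1))\<^sup>2 * interior_moment n CARD('n)"
  proof -
    have r: "?r ^ (2 * (n + 1)) = (?r ^ (n + 1))\<^sup>2" "(x \<bullet> x) * ?r ^ (2 * n) = (?r ^ (n + 1))\<^sup>2"
      by (simp_all add: dot_square_norm power2_eq_square power_add mult_2)
    have factor: "c * (a1 * (a2 * (Q * h1)) + k * X * (a2 * (a3 * (R * h0))) + m * (a2 * (Q * h1)))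
        = c * Q * (a1 * (a2 * h1) + k * (a2 * (a3 * h0)) + m * (a2 * h1))"
      if "X * R = Q" for c a1 a2 a3 Q X R h0 h1 k m :: real
      unfolding that[symmetric] by (simp add: algebra_simps)
    have args: "2 * real (n + 1) + 2 + ?d = 2 * real n + 4 + ?d" "2 * real (n + 1) + ?d = 2 * real n + 2 + ?d"
      by simp_all
    show ?thesis
      unfolding interior_moment_def r(1) power_mult_distrib[of "(real n + 3) * (real n + 2)"] args
      by (rule factor[OF r(2)])
  qed
  finally have *: "has_bochner_integral std_gaussian ?E
      (((real n + 3) * (real n + 2) * norm x ^ (n + 1))\<^sup>2 * interior_moment n CARD('n))" .
  \<comment> \<open>Off the null hyperplane \<open>u \<bullet> x = 0\<close> the explicit formula is
    exact, so junk values at the kink do not affect the integral.\<close>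
  have "AE u in std_gaussian. feature_energy (n + 3) laplacian x u = ?E u"
    using AE_std_gaussian_inner_nonzero[OF False] by eventually_elim (rule feature_energy_laplacian, simp)
  then show ?thesis
    using * by (subst has_bochner_integral_cong_AE) auto
qed

lemma has_bochner_integral_feature_energy_id:
  fixes y :: "real^'n::finite"
  shows "has_bochner_integral std_gaussian (feature_energy (n + 3) (\<lambda>f. f) y)
     ((norm y ^ (n + 3))\<^sup>2 * (half_moment (n + 3) + (real n + 3)\<^sup>2 * half_moment (n + 2)))"
proof -
  have E: "feature_energy (n + 3) (\<lambda>f. f) y u
      = tpow (2 * (n + 3)) (u \<bullet> y) + (real n + 3)\<^sup>2 * (y \<bullet> y) * tpow (2 * (n + 2)) (u \<bullet> y)" for u
  proof -
    have repu: "repu (n + 3) = tpow (n + 3)" by (rule repu_eq_tpow) simp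
    have "(\<Sum>k\<in>UNIV. ((real n + 3) * tpow (n + 2) (u \<bullet> y) * y $ k)\<^sup>2)
        = (real n + 3)\<^sup>2 * (y \<bullet> y) * (tpow (n + 2) (u \<bullet> y) * tpow (n + 2) (u \<bullet> y))"
      by (simp add: inner_vec_def sum_distrib_left sum_distrib_right power2_eq_square mult_ac)
    then show ?thesis
      unfolding feature_energy_def deriv_repu unfolding repu
      by (simp only: power2_eq_square[of "tpow _ _"] tpow_mult mult_2[symmetric])
  qed
  show ?thesis
  proof (cases "y = 0")
    case True
    then have "feature_energy (n + 3) (\<lambda>f. f) y = (\<lambda>_. 0)" using E by (simp add: fun_eq_iff)
    then show ?thesis using True by (simp add: power_0_left has_bochner_integral_zero)
  next
    case False
    have "has_bochner_integral std_gaussian (feature_energy (n + 3) (\<lambda>f. f) y)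
       (norm y ^ (2 * (n + 3)) * half_moment (n + 3)
         + (real n + 3)\<^sup>2 * (y \<bullet> y) * (norm y ^ (2 * (n + 2)) * half_moment (n + 2)))"
      unfolding E[abs_def]
      by (intro has_bochner_integral_mult_right has_bochner_integral_add
          has_bochner_integral_std_gaussian_tpow False)
    also have "norm y ^ (2 * (n + 3)) * half_moment (n + 3)
         + (real n + 3)\<^sup>2 * (y \<bullet> y) * (norm y ^ (2 * (n + 2)) * half_moment (n + 2))
       = (norm y ^ (n + 3))\<^sup>2 * (half_moment (n + 3) + (real n + 3)\<^sup>2 * half_moment (n + 2))"
    proof -
      have r: "norm y ^ (2 * (n + 3)) = (norm y ^ (n + 3))\<^sup>2"
          "(norm y ^ (n + 3))\<^sup>2 = (y \<bullet> y) * norm y ^ (2 * (n + 2))"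
        by (simp_all add: dot_square_norm power2_eq_square power_add mult_2 eval_nat_numeral)
      show ?thesis unfolding r by (simp only: algebra_simps)
    qed
    finally show ?thesis .
  qed
qed

section \<open>Eigenvalue bounds\<close>

text \<open>Two steps of the recursion produce the factors \<open>2 * n + 5\<close> and
  \<open>2 * n + 3\<close>, and the first summand of \<open>interior_moment\<close> alone already
  dominates.\<close>

lemma half_moment_le_interior_moment:
  assumes "1 \<le> d"
  shows "half_moment (n + 3) \<le> interior_moment n d"
proof -
  have "half_moment (n + 3) = (2 * real n + 5) * (2 * real n + 3) * half_moment (n + 1)"
    using half_moment_Suc[of "n + 2"] half_moment_Suc[of "n + 1"]
    by (simp add: eval_nat_numeral algebra_simps)
  also have "\<dots> \<le> (2 * real n + 4 + d) * (2 * real n + 2 + d) * half_moment (n + 1)"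
    using assms by (intro mult_right_mono mult_mono half_moment_nonneg) auto
  also have "\<dots> \<le> interior_moment n d"
    unfolding interior_moment_def using half_moment_nonneg[of "n + 1"] half_moment_nonneg[of n]
    by (simp add: mult.assoc)
  finally show ?thesis .
qed

text \<open>The constant of the upper bound, without \<open>N\<close> and \<open>B\<close>, after
  the quotient of Gamma values is evaluated as a polynomial.\<close>

definition upper_moment :: "nat \<Rightarrow> nat \<Rightarrow> real" where
  "upper_moment n d = 2 * half_moment n * (real n + 3)\<^sup>2 * (2 * real n + 2 + d) * (2 * real n + 4 + d)"

lemma interior_moment_le_upper_moment:
  assumes "2 \<le> d"
  shows "interior_moment n d \<le> upper_moment n d"
proof -
  \<comment> \<open>In terms of \<open>e\<close> all three summands share the factor
    \<open>(e - 2) * half_moment n\<close>, and \<open>d \<ge> 2\<close> becomes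
    \<open>e \<ge> 2 * N + 6\<close>.\<close>
  define N e where "N = real n" and "e = 2 * N + 4 + real d"
  have N: "0 \<le> N" and e: "2 * N + 6 \<le> e" using assms by (auto simp: N_def e_def)
  have "(N + 1)\<^sup>2 * (e - 4) + 4 * (N + 2) * (2 * N + 1) \<le> (N + 1)\<^sup>2 * e + 2 * (2 * N + 1) * e"
  proof (rule add_mono)
    show "(N + 1)\<^sup>2 * (e - 4) \<le> (N + 1)\<^sup>2 * e" by (intro mult_left_mono) auto
    have "(2 * N + 4) * (2 * N + 1) \<le> e * (2 * N + 1)" using N e by (intro mult_right_mono) auto
    then show "4 * (N + 2) * (2 * N + 1) \<le> 2 * (2 * N + 1) * e" by (simp add: algebra_simps)
  qed
  then have "(2 * N + 1) * e + (N + 1)\<^sup>2 * (e - 4) + 4 * (N + 2) * (2 * N + 1)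
      \<le> (3 * (2 * N + 1) + (N + 1)\<^sup>2) * e"
    by (simp add: algebra_simps)
  \<comment> \<open>This compares \<open>N\<^sup>2 + 8 * N + 4\<close> with
    \<open>2 * (N + 3)\<^sup>2\<close>.\<close>
  also have "\<dots> \<le> (2 * (N + 3)\<^sup>2) * e"
    using N e by (intro mult_right_mono) (auto simp: power2_eq_square algebra_simps)
  finally have "(e - 2) * half_moment n * ((2 * N + 1) * e + (N + 1)\<^sup>2 * (e - 4) + 4 * (N + 2) * (2 * N + 1))
      \<le> (e - 2) * half_moment n * ((2 * (N + 3)\<^sup>2) * e)"
    using N e by (intro mult_left_mono mult_nonneg_nonneg half_moment_nonneg) auto
  moreover have "half_moment (n + 1) = (2 * N + 1) * half_moment n"
    by (simp add: half_moment_Suc N_def)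
  ultimately show ?thesis
    unfolding interior_moment_def upper_moment_def by (simp add: N_def e_def algebra_simps)
qed

lemma boundary_moment_le_upper_moment:
  assumes "2 \<le> d"
  shows "half_moment (n + 3) + (real n + 3)\<^sup>2 * half_moment (n + 2) \<le> upper_moment n d"
proof -
  have hm: "half_moment (n + 2) = (2 * real n + 3) * (2 * real n + 1) * half_moment n"
      "half_moment (n + 3) = (2 * real n + 5) * half_moment (n + 2)"
    using half_moment_Suc[of n] half_moment_Suc[of "n + 1"] half_moment_Suc[of "n + 2"]
    by (simp_all add: eval_nat_numeral)
  have "half_moment (n + 3) + (real n + 3)\<^sup>2 * half_moment (n + 2)
      = ((2 * real n + 5) + (real n + 3)\<^sup>2) * ((2 * real n + 1) * (2 * real n + 3)) * half_moment n"
    by (simp only: hm algebra_simps)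
  \<comment> \<open>The first factor uses \<open>2 * n + 5 \<le> (n + 3)\<^sup>2\<close>; the other
    two are compared one by one.\<close>
  also have "\<dots> \<le> (2 * (real n + 3)\<^sup>2) * ((2 * real n + 2 + d) * (2 * real n + 4 + d)) * half_moment n"
    using assms by (intro mult_right_mono mult_mono half_moment_nonneg)
      (auto simp: power2_eq_square algebra_simps)
  finally show ?thesis by (simp add: upper_moment_def mult_ac)
qed

section \<open>The constants in terms of the Gamma function, and the conclusion\<close>

lemma half_moment_Gamma:
  "2 ^ (n + 3 - 1) / sqrt pi * Gamma (real (n + 3) + 1 / 2) = half_moment (n + 3)"
  by (simp add: half_moment_def power_add)

text \<open>The arguments of the Gamma quotient differ by 2, so two uses of the functional equation
  leave \<open>(z + 1) * z\<close>; the remaining Gamma value is that of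
  \<open>half_moment n\<close>.\<close>

lemma upper_moment_Gamma:
  assumes "1 \<le> d"
  shows "2 ^ (n + 3 - 1) * (real (n + 3))\<^sup>2 / sqrt pi
      * (Gamma (real (n + 3) + real d / 2) * Gamma (real (n + 3) - 5 / 2) / Gamma (real (n + 3) - 2 + real d / 2))
    = upper_moment n d"
proof -
  define z where "z = real n + 1 + real d / 2"
  have z: "0 < z" by (simp add: z_def add_pos_nonneg)
  have plus1: "Gamma (w + 1) = w * Gamma w" if "0 < w" for w :: real
    using that by (intro Gamma_plus1) (auto elim!: nonpos_Ints_cases)
  have args: "real (n + 3) + real d / 2 = z + 1 + 1" "real (n + 3) - 2 + real d / 2 = z"
      "real (n + 3) - 5 / 2 = real n + 1 / 2"
    by (simp_all add: z_def)
  have "Gamma (z + 1 + 1) = (z + 1) * z * Gamma z"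
    using z by (subst plus1, simp, subst plus1) auto
  moreover have "Gamma z \<noteq> 0" using Gamma_real_pos[OF z] by simp
  ultimately have ratio: "Gamma (z + 1 + 1) * g / Gamma z = (z + 1) * z * g" for g
    by simp
  show ?thesis
    unfolding args ratio upper_moment_def half_moment_def
    by (simp add: z_def field_simps)
qed

theorem theorem2:
  fixes \<Omega> :: "(real^'n::finite) set"
    and x :: "'p::finite \<Rightarrow> real^'n"
    and y :: "'q::finite \<Rightarrow> real^'n"
    and s :: nat
  assumes dim: "CARD('n) \<ge> 2"
    and order: "s \<ge> 3"
    and domain: "open \<Omega>" "connected \<Omega>" "bounded \<Omega>" "smooth_boundary \<Omega>"
    and interior_points: "inj x" "range x \<subseteq> \<Omega>"
    and boundary_points: "inj y" "range y \<subseteq> frontier \<Omega>"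
  shows "2 ^ (s - 1) / sqrt pi * Gamma (real s + 1 / 2) * (B_bound s x y)\<^sup>2
           \<le> lambda_max (dntk_matrix s x y) \<and>
         lambda_max (dntk_matrix s x y)
           \<le> 2 ^ (s - 1) * (real s)\<^sup>2 / sqrt pi
               * (Gamma (real s + real CARD('n) / 2) * Gamma (real s - 5 / 2)
                    / Gamma (real s - 2 + real CARD('n) / 2))
               * real (CARD('p) + CARD('q)) * (B_bound s x y)\<^sup>2"
proof -
  obtain n where s: "s = n + 3" using order by (metis add.commute le_Suc_ex)
  let ?d = "CARD('n)"
  define A where "A = dntk_matrix s x y"
  define B where "B = B_bound s x y"
  \<comment> \<open>A diagonal entry splits as \<open>(b a)\<^sup>2 * V a\<close>: the numbers
    \<open>b a\<close> are those whose maximum is \<open>B\<close>, and \<open>V a\<close> depends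
    only on the type of the point.\<close>
  define b where "b = (\<lambda>a. case a of Inl p \<Rightarrow> (real n + 3) * (real n + 2) * norm (x p) ^ (n + 1)
    | Inr q \<Rightarrow> norm (y q) ^ (n + 3))"
  define V where "V = (\<lambda>a::'p + 'q. case a of Inl p \<Rightarrow> interior_moment n ?d
    | Inr q \<Rightarrow> half_moment (n + 3) + (real n + 3)\<^sup>2 * half_moment (n + 2))"
  let ?F = "\<lambda>a. feature_energy s (sample_operator a) (sample_point x y a)"
  have bochner: "has_bochner_integral std_gaussian (?F a) ((b a)\<^sup>2 * V a)" for a
    by (cases a) (simp_all only: s b_def V_def sample_operator.simps sample_point.simps sum.case
        has_bochner_integral_feature_energy_laplacian has_bochner_integral_feature_energy_id)
  have diag: "A $ a $ a = (b a)\<^sup>2 * V a" for a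
    using bochner[of a] by (simp add: A_def dntk_matrix_def dntk_diagonal has_bochner_integral_iff)
  have entry: "\<bar>A $ a $ c\<bar> \<le> (A $ a $ a + A $ c $ c) / 2" for a c
    unfolding A_def dntk_matrix_def
    using abs_dntk_le[OF bochner[of a, THEN integrable.intros] bochner[of c, THEN integrable.intros]]
    by simp
  have sym: "transpose A = A"
    by (simp add: A_def dntk_matrix_def transpose_def dntk_commute)
  have V: "half_moment (n + 3) \<le> V a" "V a \<le> upper_moment n ?d" for a
    using dim half_moment_le_interior_moment[of ?d n] interior_moment_le_upper_moment[of ?d n]
      boundary_moment_le_upper_moment[of ?d n] half_moment_nonneg[of "n + 2"]
    by (auto simp: V_def split: sum.split)
  have b_nonneg: "0 \<le> b a" for a
    by (auto simp: b_def split: sum.split)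
  have "range b = range (b \<circ> Inl) \<union> range (b \<circ> Inr)"
    by (metis UNIV_sum image_Un image_comp)
  then have B: "B = Max (range b)"
    by (simp add: B_def B_bound_def s b_def comp_def algebra_simps)
  have "\<bar>A $ a $ c\<bar> \<le> upper_moment n ?d * B\<^sup>2" for a c
  proof -
    \<comment> \<open>A bound for the diagonal suffices, since every entry is at most the mean of
      two diagonal entries in absolute value.\<close>
    have "A $ a $ a \<le> upper_moment n ?d * B\<^sup>2" for a
    proof -
      have "b a \<le> B" unfolding B by (intro Max_ge) auto
      moreover have "0 \<le> V a" using V(1)[of a] half_moment_nonneg[of "n + 3"] by linarith
      ultimately have "(b a)\<^sup>2 * V a \<le> B\<^sup>2 * upper_moment n ?d"
        using b_nonneg V by (intro mult_mono power_mono) auto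
      then show ?thesis by (simp add: diag mult.commute)
    qed
    from add_mono[OF this[of a] this[of c]]
    have "(A $ a $ a + A $ c $ c) / 2 \<le> upper_moment n ?d * B\<^sup>2" by simp
    with entry[of a c] show ?thesis by (rule order_trans)
  qed
  from lambda_max_le_entry_bound[OF sym this]
  have upper: "lambda_max A \<le> upper_moment n ?d * real (CARD('p) + CARD('q)) * B\<^sup>2"
    by (simp add: mult_ac)
  \<comment> \<open>The lower bound comes from the diagonal entry at a point where the maximum
    \<open>B\<close> is attained.\<close>
  have "B \<in> range b" unfolding B by (intro Max_in) auto
  then obtain a where a: "B = b a" by blast
  have "half_moment (n + 3) * B\<^sup>2 \<le> A $ a $ a"
    unfolding diag a using mult_left_mono[OF V(1)[of a], of "(b a)\<^sup>2"] by (simp add: mult.commute)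
  also have "\<dots> \<le> lambda_max A" by (rule lambda_max_ge_diagonal[OF sym])
  finally show ?thesis
    using upper half_moment_Gamma[of n] upper_moment_Gamma[of ?d n] dim
    unfolding A_def B_def s by simp
qed

end
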